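(* Let $a<b$ be positive integers and, for a positive integer $j$, let $I_{\underline{a}+(\underline{j})}$ denote the defining ideal of the monomial curve $(t^{j},t^{j+a},t^{j+b})$. Then for $j\gg 0$ the Betti numbers of $I_{\underline{a}+(\underline{j})}$ are periodic in $j$ with period $b$; that is, there is an integer $N$ such that for all $j\ge N$ the ideals $I_{\underline{a}+(\underline{j})}$ and $I_{\underline{a}+(\underline{j+b})}$ have the same Betti numbers.
   Context: Let $K$ be a field of characteristic zero. The defining ideal of the monomial curve $(t^{e_0},t^{e_1},t^{e_2})$ is the kernel of the $K$-algebra map $K[x_0,x_1,x_2]\to K[t]$, $x_i\mapsto t^{e_i}$; it is homogeneous when $x_i$ is given degree $e_i$. Its Betti numbers are the (total) ranks of the free modules in its minimal graded free resolution over $K[x_0,x_1,x_2]$. Here $\underline{a}+(\underline{j})=(j,j+a,j+b)$. *)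

theory Defs
  imports
    "HOL-Library.Poly_Mapping"
    "HOL-Library.Numeral_Type"
    "HOL-Computational_Algebra.Polynomial"
    "Jordan_Normal_Form.Matrix_Kernel"
begin

text \<open>
  The polynomial ring over \<open>'k\<close> in the finitely many variables \<open>x\<^sub>v\<close>, \<open>v :: 'v\<close>.
  A monomial is its exponent vector, of type \<open>'v \<Rightarrow>\<^sub>0 nat\<close>.
\<close>

type_synonym ('v, 'k) mpol = "('v \<Rightarrow>\<^sub>0 nat) \<Rightarrow>\<^sub>0 'k"

definition weight :: "('v::finite \<Rightarrow> nat) \<Rightarrow> ('v \<Rightarrow>\<^sub>0 nat) \<Rightarrow> nat" where
  "weight e m = (\<Sum>v\<in>UNIV. e v * Poly_Mapping.lookup m v)"

text \<open>Degrees are integers, so the only polynomial that is homogeneous of a negative degree is 0.\<close>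

definition homogeneous :: "('v::finite \<Rightarrow> nat) \<Rightarrow> int \<Rightarrow> ('v, 'k::zero) mpol \<Rightarrow> bool" where
  "homogeneous e d p \<longleftrightarrow> (\<forall>m\<in>Poly_Mapping.keys p. int (weight e m) = d)"

definition monomial_curve_map :: "('v::finite \<Rightarrow> nat) \<Rightarrow> ('v, 'k::field) mpol \<Rightarrow> 'k poly" where
  "monomial_curve_map e p =
     (\<Sum>m\<in>Poly_Mapping.keys p. Polynomial.smult (Poly_Mapping.lookup p m) (\<Prod>v\<in>UNIV. Polynomial.monom 1 (e v) ^ Poly_Mapping.lookup m v))"

definition monomial_curve_ideal :: "('v::finite \<Rightarrow> nat) \<Rightarrow> ('v, 'k::field) mpol set" where
  "monomial_curve_ideal e = {p. monomial_curve_map e p = 0}"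

text \<open>
  A graded free resolution \<open>\<dots> \<rightarrow> F\<^sub>1 \<rightarrow> F\<^sub>0 \<rightarrow> I \<rightarrow> 0\<close> of a homogeneous ideal \<open>I\<close> of the polynomial ring
  \<open>S\<close>, by free modules \<open>F\<^sub>i\<close> of finite rank. \<open>F\<^sub>i\<close> is \<open>S\<^sup>r\<close> with \<open>r = dim_col (\<phi> i)\<close>, and its \<open>l\<close>-th
  basis vector has degree \<open>\<delta> i l\<close>. The matrix \<open>\<phi> 0\<close> has one row and is the augmentation
  \<open>F\<^sub>0 \<rightarrow> I \<subseteq> S\<close>; the matrix \<open>\<phi> (i + 1)\<close> is the differential \<open>F\<^sub>i\<^sub>+\<^sub>1 \<rightarrow> F\<^sub>i\<close>. Modules of rank 0 are
  allowed, so this includes resolutions of finite length.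
\<close>

definition graded_free_resolution ::
  "('v::finite \<Rightarrow> nat) \<Rightarrow> ('v, 'k::field) mpol set \<Rightarrow>
   (nat \<Rightarrow> ('v, 'k) mpol mat) \<Rightarrow> (nat \<Rightarrow> nat \<Rightarrow> int) \<Rightarrow> bool" where
  "graded_free_resolution e I \<phi> \<delta> \<longleftrightarrow>
     dim_row (\<phi> 0) = 1 \<and>
     (\<forall>i. dim_row (\<phi> (Suc i)) = dim_col (\<phi> i)) \<and>
     (\<forall>l<dim_col (\<phi> 0). homogeneous e (\<delta> 0 l) (\<phi> 0 $$ (0, l))) \<and>
     (\<forall>i. \<forall>k<dim_col (\<phi> i). \<forall>l<dim_col (\<phi> (Suc i)).
        homogeneous e (\<delta> (Suc i) l - \<delta> i k) (\<phi> (Suc i) $$ (k, l))) \<and>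
     {(\<phi> 0 *\<^sub>v u) $ 0 | u. u \<in> carrier_vec (dim_col (\<phi> 0))} = I \<and>
     (\<forall>i. mat_kernel (\<phi> i) = {\<phi> (Suc i) *\<^sub>v u | u. u \<in> carrier_vec (dim_col (\<phi> (Suc i)))})"

text \<open>
  Minimality means that \<open>F\<^sub>i\<^sub>+\<^sub>1\<close> is mapped into \<open>\<mm>F\<^sub>i\<close>, where \<open>\<mm>\<close> is the ideal generated by the
  variables, that is, the set of polynomials with constant coefficient 0. There is no such condition
  on the augmentation \<open>\<phi> 0\<close>.
\<close>

definition minimal_graded_free_resolution ::
  "('v::finite \<Rightarrow> nat) \<Rightarrow> ('v, 'k::field) mpol set \<Rightarrow>
   (nat \<Rightarrow> ('v, 'k) mpol mat) \<Rightarrow> (nat \<Rightarrow> nat \<Rightarrow> int) \<Rightarrow> bool" where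
  "minimal_graded_free_resolution e I \<phi> \<delta> \<longleftrightarrow>
     graded_free_resolution e I \<phi> \<delta> \<and>
     (\<forall>i. \<forall>k<dim_col (\<phi> i). \<forall>l<dim_col (\<phi> (Suc i)). Poly_Mapping.lookup (\<phi> (Suc i) $$ (k, l)) 0 = 0)"

text \<open>
  The \<open>i\<close>-th total Betti number of the ideal \<open>I\<close> itself (not of \<open>S/I\<close>). It is well defined when \<open>I\<close>
  is a homogeneous ideal for positive weights \<open>e\<close>: a minimal graded free resolution then exists and
  is unique up to isomorphism.
\<close>

definition betti :: "('v::finite \<Rightarrow> nat) \<Rightarrow> ('v, 'k::field) mpol set \<Rightarrow> nat \<Rightarrow> nat" where
  "betti e I i =
     (THE r. \<exists>\<phi> \<delta>. minimal_graded_free_resolution e I \<phi> \<delta> \<and> r = dim_col (\<phi> i))"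

text \<open>
  The exponents \<open>(j, j + a, j + b)\<close> of the curve. The three variables are indexed by the type \<open>3\<close>,
  whose elements are 0, 1 and 2.
\<close>

definition shifted_exponents :: "nat \<Rightarrow> nat \<Rightarrow> nat \<Rightarrow> 3 \<Rightarrow> nat" where
  "shifted_exponents a b j v = (if v = 0 then j else if v = 1 then j + a else j + b)"

definition shifted_curve_ideal :: "nat \<Rightarrow> nat \<Rightarrow> nat \<Rightarrow> (3, 'k::field) mpol set" where
  "shifted_curve_ideal a b j = monomial_curve_ideal (shifted_exponents a b j)"

end

theory Submission
  imports Defs "HOL-Number_Theory.Cong"
begin

text \<open>
  For large \<open>j\<close>, Herzog's description of monomial space curves applies with a matrix whose exponents
  are explicit: the lattice of exponent vectors of weight 0 is spanned by a vector with coordinate sum 0,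
  which does not depend on \<open>j\<close>, and by one more vector, which replacing \<open>j\<close> by \<open>j + b\<close> changes only by
  a multiple of \<open>(-1, 0, 1)\<close>. The maximal minors of the 2 by 3 matrix built from these two vectors
  generate the ideal, and the rows of the matrix generate their syzygies. This resolution is minimal
  unless one entry of the matrix is 1, in which case the ideal is a complete intersection. Which of the
  two cases occurs depends on a divisibility condition on \<open>j\<close> that is invariant under \<open>j \<mapsto> j + b\<close>.
\<close>

section \<open>Uniqueness of Betti numbers\<close>

text \<open>\<open>betti\<close> is a definite description, so a resolution determines Betti numbers
  only once ranks are known to be unique. Modulo the variables, comparison maps between two minimal
  resolutions become mutually inverse constant matrices, and traces compare their sizes.

  For the curve put \<open>g = gcd a b\<close>, \<open>d = gcd g j\<close>, \<open>a = a' g\<close>,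
  \<open>b = b' g\<close>, \<open>g = s d\<close>, \<open>j = q d\<close>, and write
  \<open>q = a' p + b' t\<close> with \<open>p < b'\<close>. The lattice of weight 0 is spanned by
  \<open>(a' - b', b', -a')\<close> and \<open>(s + p + t, -p, -t)\<close>; the coordinate sum
  \<open>s\<close> of the second is the least positive one that occurs. Largeness of
  \<open>j\<close> gives \<open>b' \<le> t\<close>, so that the exponents \<open>t\<close> and
  \<open>s + p + t - (b' - a')\<close> are positive. Passing to \<open>j + b\<close> turns
  \<open>q\<close> into \<open>q + s b'\<close>, hence \<open>t\<close> into \<open>t + s\<close>,
  and keeps \<open>p\<close>. The matrix entry that can become 1 has exponent \<open>p\<close>, and
  \<open>p = 0\<close> means that \<open>b'\<close> divides \<open>q\<close>.

  That the minors fill the whole ideal follows by counting weights: they reduce every monomial to a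
  standard one, and distinct standard monomials have distinct weights, so no combination of them
  vanishes on the curve.\<close>

lemma lookup_single_times:
  fixes p :: "'a::cancel_comm_monoid_add \<Rightarrow>\<^sub>0 'k::semiring_0"
  shows "Poly_Mapping.lookup (Poly_Mapping.single c k * p) n =
    (if \<exists>d. n = c + d then k * Poly_Mapping.lookup p (n - c) else 0)"
proof -
  let ?Q = "\<lambda>l. \<Sum>q. (Poly_Mapping.lookup p q when n = l + q)"
  have eq: "Poly_Mapping.lookup (Poly_Mapping.single c k) l * ?Q l = ((k * ?Q c) when c = l)" for l
    by (simp add: lookup_single when_def)
  have "Poly_Mapping.lookup (Poly_Mapping.single c k * p) n = k * ?Q c"
    by (subst lookup_mult) (simp only: eq Sum_any_when_equal')
  also have "?Q c =
      (if \<exists>d. n = c + d then Poly_Mapping.lookup p (n - c) else 0)"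
  proof (cases "\<exists>d. n = c + d")
    case True
    then obtain d where d: "n = c + d" by blast
    have "?Q c = (\<Sum>q. (Poly_Mapping.lookup p q when d = q))"
      unfolding d by simp
    then show ?thesis using d by simp
  next
    case False
    then have "(\<lambda>q. (Poly_Mapping.lookup p q when n = c + q)) = (\<lambda>q. 0)" by auto
    then show ?thesis using False by simp
  qed
  finally show ?thesis by simp
qed

lemma sum_single_keys:
  "(\<Sum>m\<in>Poly_Mapping.keys p. Poly_Mapping.single m (Poly_Mapping.lookup p m)) = p"
  by (rule poly_mapping_eqI)
     (simp add: lookup_sum lookup_single when_def in_keys_iff)

lemma single_add_induct [case_names zero single_add]:
  fixes p :: "'a \<Rightarrow>\<^sub>0 'b::comm_monoid_add"
  assumes "P 0" and "\<And>m k p. P p \<Longrightarrow> P (Poly_Mapping.single m k + p)"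
  shows "P p"
proof -
  have "P (\<Sum>m\<in>A. Poly_Mapping.single m (Poly_Mapping.lookup p m))" if "finite A" for A
    using that by induction (simp_all add: assms)
  then show ?thesis
    using sum_single_keys[of p] finite_keys[of p] by metis
qed

lemma exponent_add_eq_0_iff:
  fixes l q :: "'v \<Rightarrow>\<^sub>0 nat"
  shows "l + q = 0 \<longleftrightarrow> l = 0 \<and> q = 0"
  by (auto simp: poly_mapping_eq_iff fun_eq_iff lookup_add)

text \<open>The exponent 0 splits only as 0 + 0, so one term of the convolution survives. Hence
  taking constant terms is a homomorphism.\<close>

lemma lookup_mult_0:
  fixes p q :: "('v, 'k::semiring_0) mpol"
  shows "Poly_Mapping.lookup (p * q) 0 = Poly_Mapping.lookup p 0 * Poly_Mapping.lookup q 0"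
proof -
  have eq: "(\<Sum>m. (Poly_Mapping.lookup q m when 0 = l + m)) = (Poly_Mapping.lookup q 0 when l = 0)" for l
  proof -
    have "(\<Sum>m. (Poly_Mapping.lookup q m when 0 = l + m)) =
       (\<Sum>m. (Poly_Mapping.lookup q m when l = 0) when m = 0)"
      by (rule arg_cong[of _ _ Sum_any]) (auto simp: when_def fun_eq_iff exponent_add_eq_0_iff eq_commute[of 0])
    then show ?thesis by simp
  qed
  show ?thesis
    by (subst lookup_mult) (simp only: eq mult_when Sum_any_when_equal)
qed

interpretation const_term: semiring_hom "\<lambda>p :: ('v, 'k::comm_semiring_1) mpol. Poly_Mapping.lookup p 0"
  by unfold_locales (simp_all add: lookup_add lookup_mult_0)

text \<open>Reduction modulo the ideal of the variables: the matrix induced on the quotients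
  \<open>F/\<mm>F\<close> of the free modules.\<close>

abbreviation const_mat :: "('v, 'k::comm_semiring_1) mpol mat \<Rightarrow> 'k mat" where
  "const_mat \<equiv> map_mat (\<lambda>p. Poly_Mapping.lookup p 0)"

section \<open>Traces, lifting and exactness for matrices\<close>

lemma index_mat_mult_vec:
  assumes "u \<in> carrier_vec nc" and "i < nr"
  shows "(mat nr nc f *\<^sub>v u) $ i = (\<Sum>l<nc. f (i, l) * u $ l)"
  using assms by (auto simp: scalar_prod_def atLeast0LessThan intro!: sum.cong)

text \<open>\<open>A * B\<close> and \<open>B * A\<close> have the same trace, so \<open>m\<close>
  and \<open>n\<close> agree in the field; characteristic 0 makes them equal as natural
  numbers.\<close>

lemma dim_eq_if_mutually_inverse:
  fixes A B :: "'k::field_char_0 mat"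
  assumes A: "A \<in> carrier_mat m n" and B: "B \<in> carrier_mat n m"
    and "A * B = 1\<^sub>m m" and "B * A = 1\<^sub>m n"
  shows "m = n"
proof -
  have tr: "(\<Sum>i<m. (A * B) $$ (i, i)) = (\<Sum>i<m. \<Sum>j<n. A $$ (i, j) * B $$ (j, i))"
    "(\<Sum>j<n. (B * A) $$ (j, j)) = (\<Sum>j<n. \<Sum>i<m. A $$ (i, j) * B $$ (j, i))"
    using A B by (auto intro!: sum.cong simp: scalar_prod_def atLeast0LessThan mult.commute)
  have "(\<Sum>i<m. (A * B) $$ (i, i)) = (\<Sum>j<n. (B * A) $$ (j, j))"
    unfolding tr by (rule sum.swap)
  then have "(of_nat m :: 'k) = of_nat n"
    unfolding assms by simp
  then show ?thesis by simp
qed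

text \<open>Free modules are projective: the columns of \<open>C\<close> are chosen preimages of the
  columns of \<open>B\<close>.\<close>

lemma lift_columns:
  fixes A :: "'a::comm_ring_1 mat"
  assumes A: "A \<in> carrier_mat m n" and B: "B \<in> carrier_mat m l"
    and im: "\<And>i. i < l \<Longrightarrow> col B i \<in> {A *\<^sub>v u | u. u \<in> carrier_vec n}"
  shows "\<exists>C \<in> carrier_mat n l. A * C = B"
proof -
  have "\<forall>i. \<exists>u. i < l \<longrightarrow> u \<in> carrier_vec n \<and> col B i = A *\<^sub>v u"
    using im by blast
  then obtain u where u: "\<And>i. i < l \<Longrightarrow> u i \<in> carrier_vec n" "\<And>i. i < l \<Longrightarrow> col B i = A *\<^sub>v u i"
    by metis
  define C where "C = mat_of_cols n (map u [0..<l])"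
  have C: "C \<in> carrier_mat n l" unfolding C_def by auto
  have colC: "col C i = u i" if "i < l" for i
    unfolding C_def using that u(1) by (subst col_mat_of_cols) auto
  have "A * C = B"
  proof (rule mat_col_eqI)
    fix i assume "i < dim_col B"
    then have i: "i < l" using B by auto
    have "col (A * C) i = A *\<^sub>v col C i" using col_mult2[OF A C i] .
    then show "col (A * C) i = col B i" using colC u i by simp
  qed (use A B C in auto)
  then show ?thesis using C by blast
qed

lemma lift_through_kernel:
  fixes A :: "'a::comm_ring_1 mat"
  assumes A: "A \<in> carrier_mat m n" and A': "A' \<in> carrier_mat p m" and B: "B \<in> carrier_mat m l"
    and ex: "mat_kernel A' = {A *\<^sub>v u | u. u \<in> carrier_vec n}" and zero: "A' * B = 0\<^sub>m p l"
  shows "\<exists>C \<in> carrier_mat n l. A * C = B"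
proof (rule lift_columns[OF A B])
  fix i assume i: "i < l"
  have "A' *\<^sub>v col B i = 0\<^sub>v p"
    using zero A' B i by (metis carrier_matD(2) col_mult2 col_zero)
  then have "col B i \<in> mat_kernel A'"
    using A' B i by (intro mat_kernelI) auto
  then show "col B i \<in> {A *\<^sub>v u | u. u \<in> carrier_vec n}" using ex by simp
qed

lemma mult_mat_unit_vec:
  fixes A :: "'a::comm_ring_1 mat"
  assumes A: "A \<in> carrier_mat m n" and i: "i < n"
  shows "A *\<^sub>v unit_vec n i = col A i"
  using A i col_mult2[OF A one_carrier_mat i] by simp

lemma exact_mult_zero:
  fixes A :: "'a::comm_ring_1 mat"
  assumes A: "A \<in> carrier_mat m n" and A': "A' \<in> carrier_mat p m"
    and ex: "mat_kernel A' = {A *\<^sub>v u | u. u \<in> carrier_vec n}"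
  shows "A' * A = 0\<^sub>m p n"
proof (rule mat_col_eqI)
  fix i assume "i < dim_col (0\<^sub>m p n)"
  then have i: "i < n" by simp
  have "A *\<^sub>v unit_vec n i \<in> mat_kernel A'" using ex by auto
  moreover have "A *\<^sub>v unit_vec n i = col A i"
    by (rule mult_mat_unit_vec[OF A i])
  ultimately have "A' *\<^sub>v col A i = 0\<^sub>v p" using A' by (simp add: mat_kernel_def)
  then show "col (A' * A) i = col (0\<^sub>m p n) i" using A A' i col_mult2[OF A' A i] by simp
qed (use A A' in auto)

section \<open>Comparison of two minimal resolutions\<close>

lemma resolution_carrier:
  assumes "graded_free_resolution e I \<phi> \<delta>"
  shows "\<phi> (Suc i) \<in> carrier_mat (dim_col (\<phi> i)) (dim_col (\<phi> (Suc i)))"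
    and "\<phi> 0 \<in> carrier_mat 1 (dim_col (\<phi> 0))"
  using assms by (auto simp: graded_free_resolution_def)

lemma resolution_exact:
  assumes "graded_free_resolution e I \<phi> \<delta>"
  shows "mat_kernel (\<phi> i) = {\<phi> (Suc i) *\<^sub>v u | u. u \<in> carrier_vec (dim_col (\<phi> (Suc i)))}"
  using assms by (auto simp: graded_free_resolution_def)

lemma minimal_resolution_const_mat:
  assumes "minimal_graded_free_resolution e I \<phi> \<delta>"
  shows "const_mat (\<phi> (Suc i)) = 0\<^sub>m (dim_col (\<phi> i)) (dim_col (\<phi> (Suc i)))"
  using assms by (intro eq_matI) (auto simp: minimal_graded_free_resolution_def graded_free_resolution_def)

lemma const_mat_mult:
  assumes "A \<in> carrier_mat n m" and "B \<in> carrier_mat m l"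
  shows "const_mat (A * B) = const_mat A * const_mat B"
  using const_term.mat_hom_mult[OF assms] .

lemma const_mat_one: "const_mat (1\<^sub>m n) = 1\<^sub>m n"
  by (intro eq_matI) auto

lemma const_mat_add:
  assumes "A \<in> carrier_mat n m" and "B \<in> carrier_mat n m"
  shows "const_mat (A + B) = const_mat A + const_mat B"
  using assms by (intro eq_matI) (auto simp: lookup_add)

text \<open>
  \<open>F\<close> and \<open>G\<close> are the components at place \<open>i\<close> of comparison maps between two resolutions, and
  \<open>N = h\<^sub>i\<^sub>-\<^sub>1 \<phi>\<^sub>i\<close> is the part of the homotopy \<open>G F - 1 = h\<^sub>i\<^sub>-\<^sub>1 \<phi>\<^sub>i + \<phi>\<^sub>i\<^sub>+\<^sub>1 h\<^sub>i\<close> that is already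
  known at this place.
\<close>

definition comparison ::
  "(nat \<Rightarrow> ('v, 'k::field) mpol mat) \<Rightarrow> (nat \<Rightarrow> ('v, 'k) mpol mat) \<Rightarrow> nat \<Rightarrow>
   ('v, 'k) mpol mat \<Rightarrow> ('v, 'k) mpol mat \<Rightarrow> ('v, 'k) mpol mat \<Rightarrow> bool" where
  "comparison \<phi> \<psi> i F G N \<longleftrightarrow>
     F \<in> carrier_mat (dim_col (\<psi> i)) (dim_col (\<phi> i)) \<and>
     G \<in> carrier_mat (dim_col (\<phi> i)) (dim_col (\<psi> i)) \<and>
     N \<in> carrier_mat (dim_col (\<phi> i)) (dim_col (\<phi> i)) \<and>
     const_mat N = 0\<^sub>m (dim_col (\<phi> i)) (dim_col (\<phi> i)) \<and>
     N * \<phi> (Suc i) = 0\<^sub>m (dim_col (\<phi> i)) (dim_col (\<phi> (Suc i))) \<and>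
     \<phi> i * (G * F) = \<phi> i * (1\<^sub>m (dim_col (\<phi> i)) + N) \<and>
     \<psi> i * (F * \<phi> (Suc i)) = 0\<^sub>m (dim_row (\<psi> i)) (dim_col (\<phi> (Suc i)))"

text \<open>\<open>G * F - (1 + N)\<close> is killed by \<open>\<phi> i\<close>, so exactness
  factors it through \<open>\<phi> (Suc i)\<close>. Minimality kills \<open>\<phi> (Suc i)\<close>
  modulo the variables, and \<open>N\<close> vanishes there too, which leaves the identity.\<close>

lemma comparison_homotopy:
  fixes \<phi> :: "nat \<Rightarrow> ('v::finite, 'k::field) mpol mat"
  assumes res: "minimal_graded_free_resolution e I \<phi> \<delta>" and cmp: "comparison \<phi> \<psi> i F G N"
  obtains H where "H \<in> carrier_mat (dim_col (\<phi> (Suc i))) (dim_col (\<phi> i))"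
    and "G * F = 1\<^sub>m (dim_col (\<phi> i)) + N + \<phi> (Suc i) * H"
    and "const_mat G * const_mat F = 1\<^sub>m (dim_col (\<phi> i))"
proof -
  let ?n = "dim_col (\<phi> i)" and ?n' = "dim_col (\<phi> (Suc i))" and ?m = "dim_col (\<psi> i)"
  from res have r: "graded_free_resolution e I \<phi> \<delta>"
    by (simp add: minimal_graded_free_resolution_def)
  have F: "F \<in> carrier_mat ?m ?n" and G: "G \<in> carrier_mat ?n ?m" and N: "N \<in> carrier_mat ?n ?n"
    and constN: "const_mat N = 0\<^sub>m ?n ?n"
    and eq: "\<phi> i * (G * F) = \<phi> i * (1\<^sub>m ?n + N)"
    using cmp by (auto simp: comparison_def)
  have \<phi>': "\<phi> (Suc i) \<in> carrier_mat ?n ?n'" by (rule resolution_carrier[OF r])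
  have \<phi>: "\<phi> i \<in> carrier_mat (dim_row (\<phi> i)) ?n" by auto
  have GF: "G * F \<in> carrier_mat ?n ?n" and N1: "1\<^sub>m ?n + N \<in> carrier_mat ?n ?n"
    using F G N by auto
  have "\<phi> i * (G * F - (1\<^sub>m ?n + N)) = \<phi> i * (G * F) - \<phi> i * (1\<^sub>m ?n + N)"
    by (rule mult_minus_distrib_mat[OF \<phi> GF N1])
  also have "\<dots> = 0\<^sub>m (dim_row (\<phi> i)) ?n"
    unfolding eq using \<phi> N1 by (intro eq_matI) auto
  finally have zero: "\<phi> i * (G * F - (1\<^sub>m ?n + N)) = 0\<^sub>m (dim_row (\<phi> i)) ?n" .
  obtain H where H: "H \<in> carrier_mat ?n' ?n" "\<phi> (Suc i) * H = G * F - (1\<^sub>m ?n + N)"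
    using lift_through_kernel[OF \<phi>' \<phi> _ resolution_exact[OF r] zero] GF N1
    by (metis minus_carrier_mat)
  have eq2: "G * F = 1\<^sub>m ?n + N + \<phi> (Suc i) * H"
    unfolding H(2) using GF N by (intro eq_matI) auto
  have "const_mat G * const_mat F = const_mat (1\<^sub>m ?n + N + \<phi> (Suc i) * H)"
    unfolding eq2[symmetric] by (rule const_mat_mult[OF G F, symmetric])
  also have "\<dots> = 1\<^sub>m ?n + const_mat N + const_mat (\<phi> (Suc i)) * const_mat H"
    using const_mat_add[OF N1 mult_carrier_mat[OF \<phi>' H(1)]] const_mat_add[OF one_carrier_mat N]
      const_mat_mult[OF \<phi>' H(1)] by (simp add: const_mat_one)
  also have "\<dots> = 1\<^sub>m ?n"
    unfolding constN minimal_resolution_const_mat[OF res]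
    using H(1) by simp
  finally show ?thesis using that H eq2 by blast
qed

text \<open>The new \<open>N'\<close> is \<open>H * \<phi> (Suc i)\<close> for the homotopy
  \<open>H\<close> at place \<open>i\<close>. It vanishes modulo the variables by minimality, and
  \<open>N' * \<phi> (Suc (Suc i)) = 0\<close> because consecutive differentials compose to
  0.\<close>

lemma comparison_Suc:
  fixes \<phi> \<psi> :: "nat \<Rightarrow> ('v::finite, 'k::field) mpol mat"
  assumes res: "minimal_graded_free_resolution e I \<phi> \<delta>" and res': "minimal_graded_free_resolution e I \<psi> \<delta>'"
    and cmp: "comparison \<phi> \<psi> i F G N"
    and F': "F' \<in> carrier_mat (dim_col (\<psi> (Suc i))) (dim_col (\<phi> (Suc i)))"
      "\<psi> (Suc i) * F' = F * \<phi> (Suc i)"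
    and G': "G' \<in> carrier_mat (dim_col (\<phi> (Suc i))) (dim_col (\<psi> (Suc i)))"
      "\<phi> (Suc i) * G' = G * \<psi> (Suc i)"
  shows "\<exists>N'. comparison \<phi> \<psi> (Suc i) F' G' N'"
proof -
  let ?n = "dim_col (\<phi> i)" and ?m = "dim_col (\<psi> i)"
  let ?n' = "dim_col (\<phi> (Suc i))" and ?m' = "dim_col (\<psi> (Suc i))"
  let ?n'' = "dim_col (\<phi> (Suc (Suc i)))"
  from res have r: "graded_free_resolution e I \<phi> \<delta>"
    by (simp add: minimal_graded_free_resolution_def)
  from res' have r': "graded_free_resolution e I \<psi> \<delta>'"
    by (simp add: minimal_graded_free_resolution_def)
  have F: "F \<in> carrier_mat ?m ?n" and G: "G \<in> carrier_mat ?n ?m" and N: "N \<in> carrier_mat ?n ?n"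
    and N\<phi>: "N * \<phi> (Suc i) = 0\<^sub>m ?n ?n'"
    using cmp by (auto simp: comparison_def)
  have \<phi>': "\<phi> (Suc i) \<in> carrier_mat ?n ?n'" and \<phi>'': "\<phi> (Suc (Suc i)) \<in> carrier_mat ?n' ?n''"
    by (rule resolution_carrier[OF r])+
  have \<psi>': "\<psi> (Suc i) \<in> carrier_mat ?m ?m'" by (rule resolution_carrier[OF r'])
  have \<phi>\<phi>: "\<phi> (Suc i) * \<phi> (Suc (Suc i)) = 0\<^sub>m ?n ?n''"
    by (rule exact_mult_zero[OF \<phi>'' \<phi>' resolution_exact[OF r]])
  obtain H where H: "H \<in> carrier_mat ?n' ?n" and GF: "G * F = 1\<^sub>m ?n + N + \<phi> (Suc i) * H"
    using comparison_homotopy[OF res cmp] by metis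
  have H\<phi>: "H * \<phi> (Suc i) \<in> carrier_mat ?n' ?n'" by (rule mult_carrier_mat[OF H \<phi>'])
  have \<phi>H: "\<phi> (Suc i) * H \<in> carrier_mat ?n ?n" by (rule mult_carrier_mat[OF \<phi>' H])
  have "\<phi> (Suc i) * (G' * F') = (\<phi> (Suc i) * G') * F'"
    by (rule assoc_mult_mat[OF \<phi>' G'(1) F'(1), symmetric])
  also have "\<dots> = G * (\<psi> (Suc i) * F')"
    unfolding G'(2) by (rule assoc_mult_mat[OF G \<psi>' F'(1)])
  also have "\<dots> = (G * F) * \<phi> (Suc i)"
    unfolding F'(2) by (rule assoc_mult_mat[OF G F \<phi>', symmetric])
  also have "\<dots> = (1\<^sub>m ?n + N) * \<phi> (Suc i) + \<phi> (Suc i) * H * \<phi> (Suc i)"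
    unfolding GF by (rule add_mult_distrib_mat[OF _ \<phi>H \<phi>']) (use N in auto)
  also have "(1\<^sub>m ?n + N) * \<phi> (Suc i) = 1\<^sub>m ?n * \<phi> (Suc i) + N * \<phi> (Suc i)"
    by (rule add_mult_distrib_mat[OF one_carrier_mat N \<phi>'])
  also have "\<dots> = \<phi> (Suc i)"
    unfolding N\<phi> left_mult_one_mat[OF \<phi>'] by (rule right_add_zero_mat[OF \<phi>'])
  also have "\<phi> (Suc i) * H * \<phi> (Suc i) = \<phi> (Suc i) * (H * \<phi> (Suc i))"
    by (rule assoc_mult_mat[OF \<phi>' H \<phi>'])
  also have "\<phi> (Suc i) + \<phi> (Suc i) * (H * \<phi> (Suc i)) = \<phi> (Suc i) * (1\<^sub>m ?n' + H * \<phi> (Suc i))"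
    unfolding mult_add_distrib_mat[OF \<phi>' one_carrier_mat H\<phi>] right_mult_one_mat[OF \<phi>'] ..
  finally have eq: "\<phi> (Suc i) * (G' * F') = \<phi> (Suc i) * (1\<^sub>m ?n' + H * \<phi> (Suc i))" .
  have const: "const_mat (H * \<phi> (Suc i)) = 0\<^sub>m ?n' ?n'"
    unfolding const_mat_mult[OF H \<phi>'] minimal_resolution_const_mat[OF res]
    by (rule right_mult_zero_mat) (use H in simp)
  have zero: "H * \<phi> (Suc i) * \<phi> (Suc (Suc i)) = 0\<^sub>m ?n' ?n''"
    unfolding assoc_mult_mat[OF H \<phi>' \<phi>''] \<phi>\<phi> by (rule right_mult_zero_mat[OF H])
  have "\<psi> (Suc i) * (F' * \<phi> (Suc (Suc i))) = F * (\<phi> (Suc i) * \<phi> (Suc (Suc i)))"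
    unfolding assoc_mult_mat[OF \<psi>' F'(1) \<phi>'', symmetric] F'(2) by (rule assoc_mult_mat[OF F \<phi>' \<phi>''])
  also have "\<dots> = 0\<^sub>m ?m ?n''" unfolding \<phi>\<phi> by (rule right_mult_zero_mat[OF F])
  finally have "\<psi> (Suc i) * (F' * \<phi> (Suc (Suc i))) = 0\<^sub>m ?m ?n''" .
  then have "comparison \<phi> \<psi> (Suc i) F' G' (H * \<phi> (Suc i))"
    unfolding comparison_def using F'(1) G'(1) H\<phi> const zero eq carrier_matD(1)[OF \<psi>'] by metis
  then show ?thesis by blast
qed

text \<open>The last condition of \<open>comparison\<close> puts the columns of
  \<open>F * \<phi> (Suc i)\<close> into the kernel of \<open>\<psi> i\<close>, which is the image
  of \<open>\<psi> (Suc i)\<close>.\<close>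

lemma comparison_lift:
  fixes \<phi> \<psi> :: "nat \<Rightarrow> ('v::finite, 'k::field) mpol mat"
  assumes r: "graded_free_resolution e I \<phi> \<delta>" and r': "graded_free_resolution e I \<psi> \<delta>'"
    and cmp: "comparison \<phi> \<psi> i F G N"
  shows "\<exists>F' \<in> carrier_mat (dim_col (\<psi> (Suc i))) (dim_col (\<phi> (Suc i))).
    \<psi> (Suc i) * F' = F * \<phi> (Suc i)"
proof (rule lift_through_kernel[OF _ _ _ resolution_exact[OF r']])
  show "\<psi> (Suc i) \<in> carrier_mat (dim_col (\<psi> i)) (dim_col (\<psi> (Suc i)))"
    by (rule resolution_carrier[OF r'])
  show "F * \<phi> (Suc i) \<in> carrier_mat (dim_col (\<psi> i)) (dim_col (\<phi> (Suc i)))"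
    using cmp resolution_carrier[OF r] by (auto simp: comparison_def)
qed (use cmp in \<open>auto simp: comparison_def\<close>)

lemma augmentation_lift:
  fixes \<phi> \<psi> :: "nat \<Rightarrow> ('v::finite, 'k::field) mpol mat"
  assumes r: "graded_free_resolution e I \<phi> \<delta>" and r': "graded_free_resolution e I \<psi> \<delta>'"
  shows "\<exists>F \<in> carrier_mat (dim_col (\<psi> 0)) (dim_col (\<phi> 0)). \<psi> 0 * F = \<phi> 0"
proof (rule lift_columns[OF resolution_carrier(2)[OF r'] resolution_carrier(2)[OF r]])
  fix i assume i: "i < dim_col (\<phi> 0)"
  have "(\<phi> 0 *\<^sub>v unit_vec (dim_col (\<phi> 0)) i) $ 0 \<in> I"
    using r by (auto simp: graded_free_resolution_def)
  moreover have "\<phi> 0 *\<^sub>v unit_vec (dim_col (\<phi> 0)) i = col (\<phi> 0) i"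
    by (rule mult_mat_unit_vec[OF resolution_carrier(2)[OF r] i])
  ultimately obtain u where u: "u \<in> carrier_vec (dim_col (\<psi> 0))" "col (\<phi> 0) i $ 0 = (\<psi> 0 *\<^sub>v u) $ 0"
    using r' by (auto simp: graded_free_resolution_def)
  have "col (\<phi> 0) i = \<psi> 0 *\<^sub>v u"
    using u(2) carrier_matD(1)[OF resolution_carrier(2)[OF r]] carrier_matD(1)[OF resolution_carrier(2)[OF r']]
    by (intro eq_vecI) auto
  then show "col (\<phi> 0) i \<in> {\<psi> 0 *\<^sub>v u |u. u \<in> carrier_vec (dim_col (\<psi> 0))}"
    using u by blast
qed

text \<open>No homotopy comes from below the augmentation, so the induction starts with
  \<open>N = 0\<close>.\<close>

lemma comparison_0:
  fixes \<phi> \<psi> :: "nat \<Rightarrow> ('v::finite, 'k::field) mpol mat"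
  assumes r: "graded_free_resolution e I \<phi> \<delta>" and r': "graded_free_resolution e I \<psi> \<delta>'"
    and F: "F \<in> carrier_mat (dim_col (\<psi> 0)) (dim_col (\<phi> 0))" "\<psi> 0 * F = \<phi> 0"
    and G: "G \<in> carrier_mat (dim_col (\<phi> 0)) (dim_col (\<psi> 0))" "\<phi> 0 * G = \<psi> 0"
  shows "comparison \<phi> \<psi> 0 F G (0\<^sub>m (dim_col (\<phi> 0)) (dim_col (\<phi> 0)))"
proof -
  note c = resolution_carrier(2)[OF r] resolution_carrier(1)[OF r, of 0] resolution_carrier(2)[OF r']
  let ?n = "dim_col (\<phi> 0)"
  have "\<phi> 0 * (G * F) = \<phi> 0"
    using assoc_mult_mat[OF c(1) G(1) F(1)] F(2) G(2) by simp
  moreover have "\<phi> 0 * (1\<^sub>m ?n + 0\<^sub>m ?n ?n) = \<phi> 0"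
    using right_mult_one_mat[OF c(1)] by simp
  moreover have "0\<^sub>m ?n ?n * \<phi> (Suc 0) = 0\<^sub>m ?n (dim_col (\<phi> (Suc 0)))"
    by (rule left_mult_zero_mat[OF c(2)])
  moreover have "\<psi> 0 * (F * \<phi> (Suc 0)) = \<phi> 0 * \<phi> (Suc 0)"
    using assoc_mult_mat[OF c(3) F(1) c(2)] F(2) by simp
  moreover have "\<phi> 0 * \<phi> (Suc 0) = 0\<^sub>m 1 (dim_col (\<phi> (Suc 0)))"
    by (rule exact_mult_zero[OF c(2,1) resolution_exact[OF r]])
  moreover have "const_mat (0\<^sub>m k l) = 0\<^sub>m k l" for k l
    by (intro eq_matI) auto
  ultimately show ?thesis
    using F(1) G(1) carrier_matD(1)[OF c(3)] unfolding comparison_def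
    by (metis zero_carrier_mat)
qed

lemma comparison_exists:
  fixes \<phi> \<psi> :: "nat \<Rightarrow> ('v::finite, 'k::field) mpol mat"
  assumes res: "minimal_graded_free_resolution e I \<phi> \<delta>" and res': "minimal_graded_free_resolution e I \<psi> \<delta>'"
  shows "\<exists>F G N N'. comparison \<phi> \<psi> i F G N \<and> comparison \<psi> \<phi> i G F N'"
proof -
  from res have r: "graded_free_resolution e I \<phi> \<delta>"
    by (simp add: minimal_graded_free_resolution_def)
  from res' have r': "graded_free_resolution e I \<psi> \<delta>'"
    by (simp add: minimal_graded_free_resolution_def)
  show ?thesis
  proof (induction i)
    case 0
    then show ?case
      using augmentation_lift[OF r r'] augmentation_lift[OF r' r] comparison_0[OF r r'] comparison_0[OF r' r]
      by metis
  next
    case (Suc i)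
    then obtain F G N N' where cmp: "comparison \<phi> \<psi> i F G N" "comparison \<psi> \<phi> i G F N'"
      by blast
    then show ?case
      using comparison_lift[OF r r' cmp(1)] comparison_lift[OF r' r cmp(2)]
        comparison_Suc[OF res res' cmp(1)] comparison_Suc[OF res' res cmp(2)]
      by metis
  qed
qed

text \<open>Using the same pair \<open>F\<close>, \<open>G\<close> for both directions makes the two
  constant matrices inverse to each other on both sides.\<close>

lemma minimal_resolution_rank_unique:
  fixes \<phi> \<psi> :: "nat \<Rightarrow> ('v::finite, 'k::field_char_0) mpol mat"
  assumes res: "minimal_graded_free_resolution e I \<phi> \<delta>" and res': "minimal_graded_free_resolution e I \<psi> \<delta>'"
  shows "dim_col (\<phi> i) = dim_col (\<psi> i)"
proof -
  obtain F G N N' where cmp: "comparison \<phi> \<psi> i F G N" "comparison \<psi> \<phi> i G F N'"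
    using comparison_exists[OF res res'] by blast
  have "const_mat G * const_mat F = 1\<^sub>m (dim_col (\<phi> i))"
    using comparison_homotopy[OF res cmp(1)] by metis
  moreover have "const_mat F * const_mat G = 1\<^sub>m (dim_col (\<psi> i))"
    using comparison_homotopy[OF res' cmp(2)] by metis
  ultimately show ?thesis
    by (rule dim_eq_if_mutually_inverse[rotated 2]) (use cmp in \<open>auto simp: comparison_def\<close>)
qed

lemma betti_eqI:
  fixes \<phi> :: "nat \<Rightarrow> ('v::finite, 'k::field_char_0) mpol mat"
  assumes "minimal_graded_free_resolution e I \<phi> \<delta>"
  shows "betti e I i = dim_col (\<phi> i)"
  unfolding betti_def
proof (rule the_equality)
  show "\<exists>\<psi> \<delta>. minimal_graded_free_resolution e I \<psi> \<delta> \<and> dim_col (\<phi> i) = dim_col (\<psi> i)"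
    using assms by blast
qed (use minimal_resolution_rank_unique[OF assms] in auto)

section \<open>Betti numbers from a resolution of length one\<close>

lemma betti_short_resolution:
  fixes A B :: "('v::finite, 'k::field_char_0) mpol mat"
  assumes A: "A \<in> carrier_mat 1 n" and B: "B \<in> carrier_mat n m"
    and homA: "\<And>l. l < n \<Longrightarrow> homogeneous e (dA l) (A $$ (0, l))"
    and homB: "\<And>k l. k < n \<Longrightarrow> l < m \<Longrightarrow> homogeneous e (dB l - dA k) (B $$ (k, l))"
    and gen: "{(A *\<^sub>v u) $ 0 | u. u \<in> carrier_vec n} = I"
    and syz: "mat_kernel A = {B *\<^sub>v u | u. u \<in> carrier_vec m}"
    and inj: "mat_kernel B = {0\<^sub>v m}"
    and min: "\<And>k l. k < n \<Longrightarrow> l < m \<Longrightarrow> Poly_Mapping.lookup (B $$ (k, l)) 0 = 0"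
  shows "betti e I i = (if i = 0 then n else if i = 1 then m else 0)"
proof -
  \<comment> \<open>The resolution continues by zero modules. The matrix at place 2 keeps
    \<open>m\<close> rows to match the columns of \<open>B\<close>; its image is the zero vector,
    which is the kernel of the injective \<open>B\<close>.\<close>
  define \<phi> where "\<phi> = (\<lambda>i::nat. if i = 0 then A else if i = 1 then B else if i = 2 then 0\<^sub>m m 0
    else (0\<^sub>m 0 0 :: ('v, 'k) mpol mat))"
  define \<delta> where "\<delta> = (\<lambda>i::nat. if i = 0 then dA else dB)"
  have dims: "dim_col (\<phi> i) = (if i = 0 then n else if i = 1 then m else 0)" for i
    using A B by (simp add: \<phi>_def)
  have vec0: "u = 0\<^sub>v 0" if "u \<in> carrier_vec 0" for u :: "('v, 'k) mpol vec"
    using that by (intro eq_vecI) auto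
  have ker0: "mat_kernel (0\<^sub>m k 0 :: ('v, 'k) mpol mat) = {0\<^sub>v 0}" for k
    by (auto simp: mat_kernel_def intro: vec0)
  have im0: "{(0\<^sub>m k 0 :: ('v, 'k) mpol mat) *\<^sub>v u | u. u \<in> carrier_vec 0} = {0\<^sub>v k}" for k
  proof -
    have "(0\<^sub>m k 0 :: ('v, 'k) mpol mat) *\<^sub>v u = 0\<^sub>v k" if "u \<in> carrier_vec 0" for u
      using that by (intro eq_vecI) (auto simp: scalar_prod_def)
    then show ?thesis
      using zero_carrier_vec[of 0] unfolding set_eq_iff mem_Collect_eq singleton_iff by metis
  qed
  have exact: "mat_kernel (\<phi> i) = {\<phi> (Suc i) *\<^sub>v u | u. u \<in> carrier_vec (dim_col (\<phi> (Suc i)))}" for i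
  proof -
    have \<phi>: "\<phi> 0 = A" "\<phi> (Suc 0) = B" "\<phi> (Suc (Suc 0)) = 0\<^sub>m m 0" "\<phi> (Suc (Suc (Suc i))) = 0\<^sub>m 0 0" for i
      by (simp_all add: \<phi>_def)
    consider "i = 0" | "i = Suc 0" | "i = Suc (Suc 0)" | i' where "i = Suc (Suc (Suc i'))"
      by (metis not0_implies_Suc)
    then show ?thesis
    proof cases
      case 1
      have "dim_col B = m" using B by simp
      then show ?thesis unfolding 1 \<phi> syz by simp
    next
      case 2
      then show ?thesis unfolding 2 \<phi> inj index_zero_mat im0 by simp
    next
      case 3
      then show ?thesis unfolding 3 \<phi> ker0 index_zero_mat im0 by simp
    next
      case 4
      then show ?thesis unfolding 4 \<phi> ker0 index_zero_mat im0 by simp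
    qed
  qed
  have "dim_row (\<phi> (Suc i)) = dim_col (\<phi> i)" for i
    unfolding dims using B by (simp add: \<phi>_def)
  moreover have "homogeneous e (\<delta> (Suc i) l - \<delta> i k) (\<phi> (Suc i) $$ (k, l)) \<and>
      Poly_Mapping.lookup (\<phi> (Suc i) $$ (k, l)) 0 = 0"
    if "k < dim_col (\<phi> i)" "l < dim_col (\<phi> (Suc i))" for i k l
    using that homB min unfolding dims by (auto simp: \<phi>_def \<delta>_def split: if_splits)
  moreover have "homogeneous e (\<delta> 0 l) (\<phi> 0 $$ (0, l))" if "l < dim_col (\<phi> 0)" for l
    using that homA unfolding dims by (simp add: \<phi>_def \<delta>_def)
  moreover have "dim_row (\<phi> 0) = 1" "{(\<phi> 0 *\<^sub>v u) $ 0 | u. u \<in> carrier_vec (dim_col (\<phi> 0))} = I"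
    using A gen by (auto simp: \<phi>_def)
  ultimately have "minimal_graded_free_resolution e I \<phi> \<delta>"
    unfolding minimal_graded_free_resolution_def graded_free_resolution_def using exact by blast
  then show ?thesis
    using betti_eqI[of e I \<phi> \<delta> i] dims by simp
qed

section \<open>Polynomials and the curve parametrization\<close>

text \<open>Summing over any finite set that contains the support lets several polynomials share one
  index set, so additivity can be read off termwise.\<close>

lemma monomial_curve_map_superset:
  fixes p :: "('v::finite, 'k::field) mpol"
  assumes "finite A" and "Poly_Mapping.keys p \<subseteq> A"
  shows "monomial_curve_map e p = (\<Sum>m\<in>A. Polynomial.monom (Poly_Mapping.lookup p m) (weight e m))"
proof -
  have prod: "(\<Prod>v\<in>B. Polynomial.monom 1 (e v) ^ Poly_Mapping.lookup m v) =
      Polynomial.monom (1 :: 'k) (\<Sum>v\<in>B. e v * Poly_Mapping.lookup m v)" if "finite B" for B and m :: "'v \<Rightarrow>\<^sub>0 nat"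
    using that by induction (simp_all add: monom_power mult_monom mult.commute)
  have "monomial_curve_map e p =
      (\<Sum>m\<in>Poly_Mapping.keys p. Polynomial.monom (Poly_Mapping.lookup p m) (weight e m))"
    by (simp add: monomial_curve_map_def smult_monom prod weight_def)
  also have "\<dots> = (\<Sum>m\<in>A. Polynomial.monom (Poly_Mapping.lookup p m) (weight e m))"
    using assms by (intro sum.mono_neutral_left) (auto simp: in_keys_iff)
  finally show ?thesis .
qed

lemma monomial_curve_map_add:
  "monomial_curve_map e (p + q) = monomial_curve_map e p + monomial_curve_map e q"
proof -
  let ?A = "Poly_Mapping.keys p \<union> Poly_Mapping.keys q"
  have A: "finite ?A" by simp
  have "monomial_curve_map e (p + q) =
     (\<Sum>m\<in>?A. Polynomial.monom (Poly_Mapping.lookup (p + q) m) (weight e m))"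
    by (rule monomial_curve_map_superset[OF A keys_add])
  also have "\<dots> = (\<Sum>m\<in>?A. Polynomial.monom (Poly_Mapping.lookup p m) (weight e m)) +
      (\<Sum>m\<in>?A. Polynomial.monom (Poly_Mapping.lookup q m) (weight e m))"
    by (simp add: lookup_add add_monom[symmetric] sum.distrib)
  finally show ?thesis
    by (simp add: monomial_curve_map_superset[OF A])
qed

lemma monomial_curve_map_0 [simp]: "monomial_curve_map e 0 = 0"
  by (simp add: monomial_curve_map_def)

lemma monomial_curve_map_diff:
  "monomial_curve_map e (p - q) = monomial_curve_map e p - monomial_curve_map e q"
  using monomial_curve_map_add[of e "p - q" q] by simp

lemma monomial_curve_map_single:
  "monomial_curve_map e (Poly_Mapping.single m k) = Polynomial.monom k (weight e m)"
  by (subst monomial_curve_map_superset[of "{m}"]) auto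

lemma weight_add: "weight e (m + n) = weight e m + weight e n"
  by (simp add: weight_def lookup_add sum.distrib algebra_simps)

text \<open>Each term of \<open>p\<close> shifts both monomials by the same weight, so their images
  are the same power of \<open>t\<close> and cancel.\<close>

lemma monomial_curve_map_binomial_mult:
  assumes "weight e m = weight e n"
  shows "monomial_curve_map e (p * (Poly_Mapping.single m 1 - Poly_Mapping.single n 1)) = 0"
proof (induction p rule: single_add_induct)
  case (single_add c k p)
  then show ?case
    by (simp add: distrib_right monomial_curve_map_add right_diff_distrib mult_single
        monomial_curve_map_diff monomial_curve_map_single weight_add assms)
qed simp

text \<open>Distinct weights give distinct powers of \<open>t\<close>, so each coefficient of
  \<open>p\<close> survives as a coefficient of the image.\<close>

lemma monomial_curve_map_eq_0_imp_0:
  assumes inj: "inj_on (weight e) (Poly_Mapping.keys p)" and "monomial_curve_map e p = 0"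
  shows "p = 0"
proof (rule poly_mapping_eqI)
  fix m
  have eq: "(\<Sum>n\<in>Poly_Mapping.keys p. if weight e n = weight e m then Poly_Mapping.lookup p n else 0) = 0"
    using arg_cong[OF assms(2), of "\<lambda>q. Polynomial.coeff q (weight e m)"]
    by (simp add: monomial_curve_map_superset[of "Poly_Mapping.keys p"] Polynomial.coeff_sum)
  have "Poly_Mapping.lookup p m = 0" if m: "m \<in> Poly_Mapping.keys p"
  proof -
    have "(\<Sum>n\<in>Poly_Mapping.keys p. if weight e n = weight e m then Poly_Mapping.lookup p n else 0) =
       (\<Sum>n\<in>Poly_Mapping.keys p. if n = m then Poly_Mapping.lookup p n else 0)"
      using inj m by (intro sum.cong) (auto dest: inj_onD)
    then show ?thesis using eq m by simp
  qed
  then show "Poly_Mapping.lookup p m = Poly_Mapping.lookup 0 m"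
    by (auto simp: in_keys_iff)
qed

lemma lookup_scalar_times:
  fixes p :: "('v, 'k::comm_semiring_1) mpol"
  shows "Poly_Mapping.lookup (Poly_Mapping.single 0 k * p) m = k * Poly_Mapping.lookup p m"
proof -
  have "\<exists>d. m = 0 + d" by simp
  then show ?thesis by (simp only: lookup_single_times if_True diff_zero)
qed

text \<open>\<open>J\<close> is an ideal and \<open>S\<close> a set of allowed remainder monomials.
  Normal forms of monomials extend linearly to all polynomials; every division with remainder below
  is an instance.\<close>

lemma reduce_supported:
  fixes J :: "('v, 'k::comm_ring_1) mpol set"
  assumes "0 \<in> J" and add: "\<And>p q. p \<in> J \<Longrightarrow> q \<in> J \<Longrightarrow> p + q \<in> J"
    and mult: "\<And>p q. p \<in> J \<Longrightarrow> q * p \<in> J"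
    and mono: "\<And>m. \<exists>r. Poly_Mapping.single m 1 - r \<in> J \<and> Poly_Mapping.keys r \<subseteq> S"
  shows "\<exists>r. p - r \<in> J \<and> Poly_Mapping.keys r \<subseteq> S"
proof (induction p rule: single_add_induct)
  case zero
  then show ?case using \<open>0 \<in> J\<close> by (intro exI[of _ 0]) simp
next
  case (single_add m k p)
  then obtain r where r: "p - r \<in> J" "Poly_Mapping.keys r \<subseteq> S" by blast
  obtain r' where r': "Poly_Mapping.single m 1 - r' \<in> J" "Poly_Mapping.keys r' \<subseteq> S"
    using mono by blast
  let ?k = "Poly_Mapping.single 0 k"
  have "Poly_Mapping.keys (?k * r' + r) \<subseteq> S"
  proof
    fix n assume "n \<in> Poly_Mapping.keys (?k * r' + r)"
    then have "n \<in> Poly_Mapping.keys r' \<or> n \<in> Poly_Mapping.keys r"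
      by (auto simp: in_keys_iff lookup_add lookup_scalar_times)
    then show "n \<in> S" using r(2) r'(2) by blast
  qed
  moreover have "Poly_Mapping.single m k + p - (?k * r' + r) = ?k * (Poly_Mapping.single m 1 - r') + (p - r)"
  proof -
    have "?k * Poly_Mapping.single m 1 = Poly_Mapping.single m k" by (simp add: mult_single)
    then show ?thesis unfolding right_diff_distrib by simp
  qed
  ultimately show ?case
    using add[OF mult[OF r'(1), of ?k] r(1)] by metis
qed

subsection \<open>Three variables\<close>

lemma exhaust_3: "v = 0 \<or> v = 1 \<or> v = 2" for v :: 3
proof (induct v)
  case (of_int z)
  then have "z = 0 \<or> z = 1 \<or> z = 2" by simp arith
  then show ?case by auto
qed

lemma UNIV_3: "UNIV = {0, 1, 2 :: 3}"
  using exhaust_3 by blast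

lemma distinct_3 [simp]: "(0::3) \<noteq> 1" "(0::3) \<noteq> 2" "(1::3) \<noteq> 2" "(1::3) \<noteq> 0" "(2::3) \<noteq> 0" "(2::3) \<noteq> 1"
  by simp_all

definition mon :: "nat \<Rightarrow> nat \<Rightarrow> nat \<Rightarrow> (3 \<Rightarrow>\<^sub>0 nat)" where
  "mon x y z = Poly_Mapping.single 0 x + Poly_Mapping.single 1 y + Poly_Mapping.single 2 z"

lemma lookup_mon:
  "Poly_Mapping.lookup (mon x y z) v = (if v = 0 then x else if v = 1 then y else z)"
  using exhaust_3[of v] by (auto simp: mon_def lookup_add lookup_single)

lemma mon_exhaust: obtains x y z where "m = mon x y z"
proof
  show "m = mon (Poly_Mapping.lookup m 0) (Poly_Mapping.lookup m 1) (Poly_Mapping.lookup m 2)"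
  proof (rule poly_mapping_eqI)
    fix v show "Poly_Mapping.lookup m v = Poly_Mapping.lookup
        (mon (Poly_Mapping.lookup m 0) (Poly_Mapping.lookup m 1) (Poly_Mapping.lookup m 2)) v"
      using exhaust_3[of v] by (auto simp: lookup_mon)
  qed
qed

lemma mon_eq_iff [simp]: "mon x y z = mon x' y' z' \<longleftrightarrow> x = x' \<and> y = y' \<and> z = z'"
proof
  assume "mon x y z = mon x' y' z'"
  then have "Poly_Mapping.lookup (mon x y z) v = Poly_Mapping.lookup (mon x' y' z') v" for v by simp
  from this[of 0] this[of 1] this[of 2] show "x = x' \<and> y = y' \<and> z = z'"
    by (simp add: lookup_mon)
qed simp

lemma mon_add: "mon x y z + mon x' y' z' = mon (x + x') (y + y') (z + z')"
  by (rule poly_mapping_eqI) (simp add: lookup_add lookup_mon)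

lemma mon_0: "mon 0 0 0 = 0"
  by (simp add: mon_def)

lemma weight_mon: "weight e (mon x y z) = e 0 * x + e 1 * y + e 2 * z"
proof -
  have "weight e m = e 0 * Poly_Mapping.lookup m 0 + e 1 * Poly_Mapping.lookup m 1 + e 2 * Poly_Mapping.lookup m 2" for m
    unfolding weight_def UNIV_3 by (subst sum.insert, simp, simp only: insert_iff empty_iff distinct_3 simp_thms not_False_eq_True)+ (simp add: add.assoc)
  then show ?thesis by (simp only: lookup_mon distinct_3 if_True if_False simp_thms)
qed

definition mpow :: "nat \<Rightarrow> nat \<Rightarrow> nat \<Rightarrow> (3, 'k::field) mpol" where
  "mpow x y z = Poly_Mapping.single (mon x y z) 1"

lemma mpow_mult: "mpow x y z * mpow x' y' z' = mpow (x + x') (y + y') (z + z')"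
  by (simp add: mpow_def mult_single mon_add)

lemma mpow_0: "mpow 0 0 0 = 1"
  by (simp add: mpow_def mon_0)

lemma lookup_mpow_times:
  "Poly_Mapping.lookup (mpow a b c * p) (mon x y z) =
    (if a \<le> x \<and> b \<le> y \<and> c \<le> z then Poly_Mapping.lookup p (mon (x - a) (y - b) (z - c)) else 0)"
proof (cases "a \<le> x \<and> b \<le> y \<and> c \<le> z")
  case True
  then have eq: "mon x y z = mon a b c + mon (x - a) (y - b) (z - c)"
    by (simp add: mon_add)
  then have "mon x y z - mon a b c = mon (x - a) (y - b) (z - c)"
    by (metis add_diff_cancel_left')
  then show ?thesis
    using True eq by (auto simp: mpow_def lookup_single_times)
next
  case False
  have "\<nexists>d. mon x y z = mon a b c + d"
  proof
    assume "\<exists>d. mon x y z = mon a b c + d"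
    then obtain d where "mon x y z = mon a b c + d" by blast
    moreover obtain x' y' z' where "d = mon x' y' z'" by (rule mon_exhaust)
    ultimately show False using False by (auto simp: mon_add)
  qed
  then show ?thesis
    using False by (simp only: mpow_def lookup_single_times if_False)
qed

lemma mpol_eq_0I:
  assumes "\<And>x y z. Poly_Mapping.lookup p (mon x y z) = 0"
  shows "p = 0"
proof (rule poly_mapping_eqI)
  fix m
  obtain x y z where m: "m = mon x y z" by (rule mon_exhaust)
  show "Poly_Mapping.lookup p m = Poly_Mapping.lookup 0 m"
    using assms by (simp add: m)
qed

lemma lookup_mpow_0: "Poly_Mapping.lookup (mpow x y z) 0 = (if x = 0 \<and> y = 0 \<and> z = 0 then 1 else 0)"
  using mon_eq_iff[of x y z 0 0 0] by (simp add: mpow_def lookup_single mon_0 del: mon_eq_iff)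

lemma homogeneous_mpow:
  "d = int (e 0 * x + e 1 * y + e 2 * z) \<Longrightarrow> homogeneous e d (mpow x y z :: (3, 'k::field) mpol)"
  by (simp add: homogeneous_def mpow_def weight_mon)

lemma homogeneous_diff:
  fixes p q :: "('v::finite, 'k::field) mpol"
  shows "homogeneous e d p \<Longrightarrow> homogeneous e d q \<Longrightarrow> homogeneous e d (p - q)"
  unfolding homogeneous_def by (auto simp: in_keys_iff lookup_minus)

lemma homogeneous_uminus:
  fixes p :: "('v::finite, 'k::field) mpol"
  shows "homogeneous e d p \<Longrightarrow> homogeneous e d (- p)"
  unfolding homogeneous_def by (simp add: in_keys_iff)

section \<open>Generators and syzygies of the curve ideal\<close>

text \<open>
  The exponents of the matrix with rows \<open>(x\<^bsup>\<alpha>0\<^esup>, y\<^bsup>\<alpha>1\<^esup>, z\<^bsup>\<alpha>2\<^esup>)\<close> and \<open>(y\<^bsup>\<beta>1\<^esup>, z\<^bsup>\<beta>2\<^esup>, x\<^bsup>\<beta>0\<^esup>)\<close>, whose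
  maximal minors generate the ideal. The ideal is a complete intersection iff \<open>\<beta>1 = 0\<close>.
\<close>

locale space_curve =
  fixes e :: "3 \<Rightarrow> nat" and \<alpha>0 \<alpha>1 \<alpha>2 \<beta>0 \<beta>1 \<beta>2 :: nat
  assumes pos: "0 < \<alpha>0" "0 < \<alpha>1" "0 < \<alpha>2" "0 < \<beta>0" "0 < \<beta>2" "0 < e 2"
    and weight1: "e 0 * \<alpha>0 + e 2 * \<beta>2 = e 1 * (\<alpha>1 + \<beta>1)"
    and weight2: "e 0 * (\<alpha>0 + \<beta>0) = e 1 * \<beta>1 + e 2 * \<alpha>2"
    and lattice: "\<And>u v w :: int. int (e 0) * u + int (e 1) * v + int (e 2) * w = 0 \<Longrightarrow>
      \<exists>k l. u = - k * int \<alpha>0 + l * int (\<alpha>0 + \<beta>0) \<and> v = k * int (\<alpha>1 + \<beta>1) - l * int \<beta>1 \<and>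
        w = - k * int \<beta>2 - l * int \<alpha>2"
begin

section \<open>The three minors and the curve ideal\<close>

lemma weight3: "e 0 * \<beta>0 + e 1 * \<alpha>1 = e 2 * (\<alpha>2 + \<beta>2)"
  using weight1 weight2 by (simp add: algebra_simps)

definition D1 :: "(3, 'k::field) mpol" where "D1 = mpow \<alpha>0 0 \<beta>2 - mpow 0 (\<alpha>1 + \<beta>1) 0"
definition D2 :: "(3, 'k::field) mpol" where "D2 = mpow (\<alpha>0 + \<beta>0) 0 0 - mpow 0 \<beta>1 \<alpha>2"
definition D3 :: "(3, 'k::field) mpol" where "D3 = mpow \<beta>0 \<alpha>1 0 - mpow 0 0 (\<alpha>2 + \<beta>2)"

lemma D_eqs:
  "D1 = mpow \<alpha>0 0 0 * mpow 0 0 \<beta>2 - mpow 0 \<alpha>1 0 * mpow 0 \<beta>1 0"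
  "D2 = mpow \<alpha>0 0 0 * mpow \<beta>0 0 0 - mpow 0 \<beta>1 0 * mpow 0 0 \<alpha>2"
  "D3 = mpow \<beta>0 0 0 * mpow 0 \<alpha>1 0 - mpow 0 0 \<alpha>2 * mpow 0 0 \<beta>2"
  by (simp_all add: D1_def D2_def D3_def mpow_mult)

text \<open>These are the expansions of two 3 by 3 determinants, in which the first or the second
  row of the matrix is repeated.\<close>

lemma relation1: "mpow 0 0 \<alpha>2 * D1 - mpow 0 \<alpha>1 0 * D2 + mpow \<alpha>0 0 0 * D3 = 0"
  and relation2: "mpow \<beta>0 0 0 * D1 - mpow 0 0 \<beta>2 * D2 + mpow 0 \<beta>1 0 * D3 = 0"
  by (simp_all add: D_eqs algebra_simps)

definition minors :: "(3, 'k::field) mpol set" where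
  "minors = {D1 * u + D2 * v + D3 * w | u v w. True}"

lemma minors_add: "p \<in> minors \<Longrightarrow> q \<in> minors \<Longrightarrow> p + q \<in> minors"
proof -
  assume "p \<in> minors" "q \<in> minors"
  then obtain u v w u' v' w' where
    "p = D1 * u + D2 * v + D3 * w" "q = D1 * u' + D2 * v' + D3 * w'"
    unfolding minors_def by blast
  then have "p + q = D1 * (u + u') + D2 * (v + v') + D3 * (w + w')"
    by (simp add: algebra_simps)
  then show ?thesis unfolding minors_def by blast
qed

lemma minors_mult: "p \<in> minors \<Longrightarrow> q * p \<in> minors"
proof -
  assume "p \<in> minors"
  then obtain u v w where "p = D1 * u + D2 * v + D3 * w"
    unfolding minors_def by blast
  then have "q * p = D1 * (q * u) + D2 * (q * v) + D3 * (q * w)"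
    by (simp add: algebra_simps)
  then show ?thesis unfolding minors_def by blast
qed

lemma minors_basic:
  "(0 :: (3, 'k::field) mpol) \<in> minors" "(D1 :: (3, 'k) mpol) \<in> minors"
  "(D2 :: (3, 'k) mpol) \<in> minors" "(D3 :: (3, 'k) mpol) \<in> minors"
proof -
  have "D1 * u + D2 * v + D3 * w \<in> minors" for u v w :: "(3, 'k) mpol"
    unfolding minors_def by blast
  from this[of 0 0 0] this[of 1 0 0] this[of 0 1 0] this[of 0 0 1]
  show "(0 :: (3, 'k) mpol) \<in> minors" "(D1 :: (3, 'k) mpol) \<in> minors"
    "(D2 :: (3, 'k) mpol) \<in> minors" "(D3 :: (3, 'k) mpol) \<in> minors" by simp_all
qed

lemma minors_subset: "(minors :: (3, 'k::field) mpol set) \<subseteq> monomial_curve_ideal e"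
proof
  fix p :: "(3, 'k) mpol" assume "p \<in> minors"
  then obtain u v w where p: "p = u * D1 + v * D2 + w * D3"
    unfolding minors_def by (auto simp: mult.commute)
  have "monomial_curve_map e (u * D1) = 0" "monomial_curve_map e (v * D2) = 0" "monomial_curve_map e (w * D3) = 0"
    unfolding D1_def D2_def D3_def mpow_def
    using weight1 weight2 weight3 by (intro monomial_curve_map_binomial_mult; simp add: weight_mon)+
  then show "p \<in> monomial_curve_ideal e"
    by (simp add: p monomial_curve_ideal_def monomial_curve_map_add)
qed

text \<open>
  The initial terms of the minors for the reverse lexicographic order are \<open>y\<^bsup>\<alpha>1+\<beta>1\<^esup>\<close>, \<open>x\<^bsup>\<alpha>0+\<beta>0\<^esup>\<close> and
  \<open>x\<^bsup>\<beta>0\<^esup> y\<^bsup>\<alpha>1\<^esup>\<close>; these are the exponents of the monomials outside the initial ideal.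
\<close>

definition standard :: "(3 \<Rightarrow>\<^sub>0 nat) set" where
  "standard = {mon x y z | x y z. y < \<alpha>1 + \<beta>1 \<and> x < \<alpha>0 + \<beta>0 \<and> \<not> (\<beta>0 \<le> x \<and> \<alpha>1 \<le> y)}"

text \<open>Every rewriting by a minor preserves the total weight and raises the exponent of
  \<open>z\<close>. The weight carried by \<open>x\<close> and \<open>y\<close> alone therefore
  drops, which makes it a measure for the induction.\<close>

lemma monomial_reduces:
  "\<exists>m \<in> standard. mpow x y z - Poly_Mapping.single m 1 \<in> (minors :: (3, 'k::field) mpol set)"
proof (induction "e 0 * x + e 1 * y" arbitrary: x y z rule: less_induct)
  case less
  have step: ?case if lt: "e 0 * x' + e 1 * y' < e 0 * x + e 1 * y"
    and red: "mpow x y z - mpow x' y' z' \<in> (minors :: (3, 'k) mpol set)" for x' y' z'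
  proof -
    obtain m where m: "m \<in> standard" "mpow x' y' z' - Poly_Mapping.single m 1 \<in> (minors :: (3, 'k) mpol set)"
      using less[OF lt] by blast
    have "mpow x y z - Poly_Mapping.single m 1 \<in> (minors :: (3, 'k) mpol set)"
      using minors_add[OF red m(2)] by simp
    then show ?thesis using m(1) by blast
  qed
  have w: "e 0 * \<alpha>0 < e 1 * (\<alpha>1 + \<beta>1)" "e 1 * \<beta>1 < e 0 * (\<alpha>0 + \<beta>0)" "0 < e 0 * \<beta>0 + e 1 * \<alpha>1"
    using pos weight1 weight2 weight3
    by (metis less_add_same_cancel1 mult_pos_pos, metis less_add_same_cancel1 mult_pos_pos, metis add_pos_pos mult_pos_pos)
  consider "\<alpha>1 + \<beta>1 \<le> y" | "\<alpha>0 + \<beta>0 \<le> x" | "\<beta>0 \<le> x" "\<alpha>1 \<le> y" | "mon x y z \<in> standard"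
    unfolding standard_def by fastforce
  then show ?case
  proof cases
    case 1
    then obtain y' where y: "y = \<alpha>1 + \<beta>1 + y'" using le_Suc_ex by blast
    show ?thesis
    proof (rule step)
      show "e 0 * (x + \<alpha>0) + e 1 * y' < e 0 * x + e 1 * y"
        using w(1) by (simp add: y algebra_simps)
      have "mpow x y z - mpow (x + \<alpha>0) y' (z + \<beta>2) = - mpow x y' z * (D1 :: (3, 'k) mpol)"
        by (simp add: D1_def algebra_simps mpow_mult y)
      then show "mpow x y z - mpow (x + \<alpha>0) y' (z + \<beta>2) \<in> (minors :: (3, 'k) mpol set)"
        by (metis minors_mult minors_basic(2))
    qed
  next
    case 2
    then obtain x' where x: "x = \<alpha>0 + \<beta>0 + x'" using le_Suc_ex by blast
    show ?thesis
    proof (rule step)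
      show "e 0 * x' + e 1 * (y + \<beta>1) < e 0 * x + e 1 * y"
        using w(2) by (simp add: x algebra_simps)
      have "mpow x y z - mpow x' (y + \<beta>1) (z + \<alpha>2) = mpow x' y z * (D2 :: (3, 'k) mpol)"
        by (simp add: D2_def algebra_simps mpow_mult x)
      then show "mpow x y z - mpow x' (y + \<beta>1) (z + \<alpha>2) \<in> (minors :: (3, 'k) mpol set)"
        by (metis minors_mult minors_basic(3))
    qed
  next
    case 3
    then obtain x' y' where x: "x = \<beta>0 + x'" and y: "y = \<alpha>1 + y'" by (metis le_Suc_ex)
    show ?thesis
    proof (rule step)
      show "e 0 * x' + e 1 * y' < e 0 * x + e 1 * y"
        using w(3) by (simp add: x y algebra_simps)
      have "mpow x y z - mpow x' y' (z + (\<alpha>2 + \<beta>2)) = mpow x' y' z * (D3 :: (3, 'k) mpol)"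
        by (simp add: D3_def algebra_simps mpow_mult x y)
      then show "mpow x y z - mpow x' y' (z + (\<alpha>2 + \<beta>2)) \<in> (minors :: (3, 'k) mpol set)"
        by (metis minors_mult minors_basic(4))
    qed
  next
    case 4
    have "mpow x y z - Poly_Mapping.single (mon x y z) 1 \<in> (minors :: (3, 'k) mpol set)"
      using minors_basic(1) by (simp add: mpow_def)
    then show ?thesis using 4 by blast
  qed
qed

text \<open>Grouping by \<open>k - l\<close> shows which initial monomial divides the monomial with
  exponents \<open>x\<close>, \<open>y\<close>: the power of \<open>y\<close> for
  \<open>k > l\<close>, the power of \<open>x\<close> for \<open>k < l\<close>, the mixed one for
  \<open>k = l\<close>.\<close>

lemma lattice_vector_nonstandard:
  fixes k l :: int and x y x' y' :: nat
  assumes u: "int x - int x' = - k * int \<alpha>0 + l * int (\<alpha>0 + \<beta>0)"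
    and v: "int y - int y' = k * int (\<alpha>1 + \<beta>1) - l * int \<beta>1"
    and "0 < k \<or> 0 < l"
  shows "\<alpha>1 + \<beta>1 \<le> y \<or> \<alpha>0 + \<beta>0 \<le> x \<or> (\<beta>0 \<le> x \<and> \<alpha>1 \<le> y)"
proof -
  have u': "int x - int x' = (l - k) * int \<alpha>0 + l * int \<beta>0"
    using u by (simp add: algebra_simps)
  have v': "int y - int y' = k * int \<alpha>1 + (k - l) * int \<beta>1"
    using v by (simp add: algebra_simps)
  have le: "int c \<le> i * int c" if "1 \<le> i" for i c
    using mult_right_mono[OF that, of "int c"] by simp
  consider "l < k" "1 \<le> k" | "k < l" "1 \<le> l" | "k = l" "1 \<le> k"
    using assms(3) by linarith
  then show ?thesis
  proof cases
    case 1
    then have "int y \<ge> int \<alpha>1 + int \<beta>1" using le[of k \<alpha>1] le[of "k - l" \<beta>1] v' by linarith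
    then show ?thesis by linarith
  next
    case 2
    then have "int x \<ge> int \<alpha>0 + int \<beta>0" using le[of l \<beta>0] le[of "l - k" \<alpha>0] u' by linarith
    then show ?thesis by linarith
  next
    case 3
    then have "int x \<ge> int \<beta>0" "int y \<ge> int \<alpha>1"
      using le[of k \<alpha>1] le[of k \<beta>0] u' v' by simp_all
    then show ?thesis by linarith
  qed
qed

text \<open>Equal weights make the difference a lattice vector with parameters \<open>k\<close>,
  \<open>l\<close>. If these are not both 0, then \<open>(k, l)\<close> or \<open>(-k, -l)\<close>
  has a positive entry, so one of the two monomials is not standard.\<close>

lemma inj_on_weight_standard: "inj_on (weight e) standard"
proof (rule inj_onI)
  fix m m' assume "m \<in> standard" "m' \<in> standard" and w: "weight e m = weight e m'"
  then obtain x y z x' y' z' where m: "m = mon x y z" and m': "m' = mon x' y' z'"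
    and std: "\<not> (\<alpha>1 + \<beta>1 \<le> y \<or> \<alpha>0 + \<beta>0 \<le> x \<or> (\<beta>0 \<le> x \<and> \<alpha>1 \<le> y))"
    and std': "\<not> (\<alpha>1 + \<beta>1 \<le> y' \<or> \<alpha>0 + \<beta>0 \<le> x' \<or> (\<beta>0 \<le> x' \<and> \<alpha>1 \<le> y'))"
    unfolding standard_def by fastforce
  have "int (e 0 * x + e 1 * y + e 2 * z) = int (e 0 * x' + e 1 * y' + e 2 * z')"
    using w unfolding m m' weight_mon by simp
  then have "int (e 0) * (int x - int x') + int (e 1) * (int y - int y') + int (e 2) * (int z - int z') = 0"
    by (simp add: algebra_simps)
  from lattice[OF this] obtain k l where
    u: "int x - int x' = - k * int \<alpha>0 + l * int (\<alpha>0 + \<beta>0)" and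
    v: "int y - int y' = k * int (\<alpha>1 + \<beta>1) - l * int \<beta>1" and
    z: "int z - int z' = - k * int \<beta>2 - l * int \<alpha>2" by blast
  have u': "int x' - int x = - (- k) * int \<alpha>0 + (- l) * int (\<alpha>0 + \<beta>0)"
    and v': "int y' - int y = (- k) * int (\<alpha>1 + \<beta>1) - (- l) * int \<beta>1"
    using u v by linarith+
  have "k = 0 \<and> l = 0"
  proof (rule ccontr)
    assume "\<not> (k = 0 \<and> l = 0)"
    then show False
      using lattice_vector_nonstandard[OF u v] std lattice_vector_nonstandard[OF u' v'] std' by linarith
  qed
  then show "m = m'" using u v z by (simp add: m m')
qed

lemma curve_ideal_eq: "monomial_curve_ideal e = minors"
proof
  show "monomial_curve_ideal e \<subseteq> (minors :: (3, 'k::field) mpol set)"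
  proof
    fix p :: "(3, 'k) mpol" assume p: "p \<in> monomial_curve_ideal e"
    have "\<exists>r. p - r \<in> minors \<and> Poly_Mapping.keys r \<subseteq> standard"
    proof (rule reduce_supported[OF minors_basic(1) minors_add minors_mult])
      fix m :: "3 \<Rightarrow>\<^sub>0 nat"
      obtain x y z where m: "m = mon x y z" by (rule mon_exhaust)
      obtain n where "n \<in> standard" "mpow x y z - Poly_Mapping.single n 1 \<in> (minors :: (3, 'k) mpol set)"
        using monomial_reduces by blast
      then show "\<exists>r. Poly_Mapping.single m 1 - r \<in> (minors :: (3, 'k) mpol set) \<and> Poly_Mapping.keys r \<subseteq> standard"
        unfolding m mpow_def by (intro exI[of _ "Poly_Mapping.single n 1"]) auto
    qed
    then obtain r where r: "p - r \<in> minors" "Poly_Mapping.keys r \<subseteq> standard" by blast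
    have "monomial_curve_map e (p - r) = 0"
      using minors_subset r(1) unfolding monomial_curve_ideal_def by blast
    then have "monomial_curve_map e r = 0"
      using p by (simp add: monomial_curve_map_diff monomial_curve_ideal_def)
    then have "r = 0"
      by (rule monomial_curve_map_eq_0_imp_0[OF inj_on_subset[OF inj_on_weight_standard r(2)]])
    then show "p \<in> minors" using r(1) by simp
  qed
qed (rule minors_subset)

text \<open>
  Modulo \<open>z\<close> the equation becomes \<open>x\<^bsup>\<alpha>0+\<beta>0\<^esup> v = y\<^bsup>\<alpha>1+\<beta>1\<^esup> r\<close>. Hence the terms of lowest degree
  in \<open>z\<close> of a nonzero solution would contradict the support condition on \<open>r\<close>.
\<close>

lemma regular_pair_aux:
  fixes r v :: "(3, 'k::field) mpol"
  assumes eq: "D1 * r + D2 * v = 0"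
    and supp: "\<And>x y z. \<alpha>0 + \<beta>0 \<le> x \<Longrightarrow> Poly_Mapping.lookup r (mon x y z) = 0"
  shows "r = 0 \<and> v = 0"
proof -
  have coeff: "Poly_Mapping.lookup (D1 * r) m + Poly_Mapping.lookup (D2 * v) m = 0" for m
    using arg_cong[OF eq, of "\<lambda>p. Poly_Mapping.lookup p m"] by (simp add: lookup_add)
  have zero: "\<forall>x y. Poly_Mapping.lookup r (mon x y z) = 0 \<and> Poly_Mapping.lookup v (mon x y z) = 0" for z
  proof (induction z rule: less_induct)
    case (less z)
    have IH: "Poly_Mapping.lookup r (mon x y (z - c)) = 0" "Poly_Mapping.lookup v (mon x y (z - c)) = 0"
      if "0 < c" "c \<le> z" for x y c
      using less[of "z - c"] that by auto
    show ?case
    proof (intro allI conjI)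
      fix x y
      show "Poly_Mapping.lookup r (mon x y z) = 0"
      proof (cases "\<alpha>0 + \<beta>0 \<le> x")
        case False
        then show ?thesis
          using coeff[of "mon x (y + (\<alpha>1 + \<beta>1)) z"] IH pos
          by (auto simp: D1_def D2_def left_diff_distrib lookup_minus lookup_mpow_times split: if_splits)
      qed (rule supp)
      show "Poly_Mapping.lookup v (mon x y z) = 0"
        using coeff[of "mon (x + (\<alpha>0 + \<beta>0)) y z"] IH pos supp
        by (auto simp: D1_def D2_def left_diff_distrib lookup_minus lookup_mpow_times split: if_splits)
    qed
  qed
  show ?thesis
    using zero by (intro conjI mpol_eq_0I) blast+
qed

lemma D2_mult_eq_0: "D2 * v = 0 \<Longrightarrow> v = 0"
  using regular_pair_aux[of 0 v] by simp

section \<open>Division with remainder and syzygies\<close>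

text \<open>As a polynomial in \<open>x\<close>, \<open>D2\<close> is monic of degree
  \<open>\<alpha>0 + \<beta>0\<close> with its other term free of \<open>x\<close>, so each
  rewriting lowers the exponent of \<open>x\<close>.\<close>

lemma division_by_D2:
  fixes u :: "(3, 'k::field) mpol"
  obtains q r where "u = D2 * q + r" and "\<And>x y z. \<alpha>0 + \<beta>0 \<le> x \<Longrightarrow> Poly_Mapping.lookup r (mon x y z) = 0"
proof -
  let ?J = "{D2 * q | q. True} :: (3, 'k) mpol set"
  let ?S = "{mon x y z | x y z. x < \<alpha>0 + \<beta>0}"
  have J: "D2 * q \<in> ?J" for q by blast
  have add: "p + q \<in> ?J" if "p \<in> ?J" "q \<in> ?J" for p q
    using that J by (auto simp flip: distrib_left)
  have mult: "q * p \<in> ?J" if "p \<in> ?J" for p q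
    using that J by (auto simp: mult.left_commute)
  have mono: "\<exists>r. mpow x y z - r \<in> ?J \<and> Poly_Mapping.keys r \<subseteq> ?S" for x y z
  proof (induction x arbitrary: y z rule: less_induct)
    case (less x)
    show ?case
    proof (cases "x < \<alpha>0 + \<beta>0")
      case True
      have "mpow x y z - mpow x y z \<in> ?J" using J[of 0] by simp
      moreover have "Poly_Mapping.keys (mpow x y z :: (3, 'k) mpol) \<subseteq> ?S" using True by (auto simp: mpow_def)
      ultimately show ?thesis by blast
    next
      case False
      then obtain x' where x: "x = \<alpha>0 + \<beta>0 + x'" by (metis le_Suc_ex not_less)
      obtain r where r: "mpow x' (y + \<beta>1) (z + \<alpha>2) - r \<in> ?J" "Poly_Mapping.keys r \<subseteq> ?S"
        using less[of x' "y + \<beta>1" "z + \<alpha>2"] pos x by auto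
      have eq: "mpow x y z - mpow x' (y + \<beta>1) (z + \<alpha>2) = D2 * (mpow x' y z :: (3, 'k) mpol)"
        by (simp add: D2_def left_diff_distrib mpow_mult x add.commute)
      have "mpow x y z - mpow x' (y + \<beta>1) (z + \<alpha>2) \<in> ?J" unfolding eq by (rule J)
      from add[OF this r(1)] have "mpow x y z - r \<in> ?J" by simp
      then show ?thesis using r(2) by blast
    qed
  qed
  have "\<exists>r. u - r \<in> ?J \<and> Poly_Mapping.keys r \<subseteq> ?S"
  proof (rule reduce_supported[OF _ add mult])
    show "0 \<in> ?J" using J[of 0] by simp
    show "\<exists>r. Poly_Mapping.single m 1 - r \<in> ?J \<and> Poly_Mapping.keys r \<subseteq> ?S" for m
    proof -
      obtain x y z where m: "m = mon x y z" by (rule mon_exhaust)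
      show ?thesis using mono[of x y z] unfolding m mpow_def .
    qed
  qed
  then obtain r q where r: "u - r = D2 * q" "Poly_Mapping.keys r \<subseteq> ?S" by blast
  show ?thesis
  proof (rule that)
    show "u = D2 * q + r" using r(1) by (simp add: algebra_simps)
    show "Poly_Mapping.lookup r (mon x y z) = 0" if "\<alpha>0 + \<beta>0 \<le> x" for x y z
    proof -
      have "mon x y z \<notin> ?S" using that by auto
      then show ?thesis using r(2) by (auto simp: in_keys_iff)
    qed
  qed
qed

text \<open>\<open>D1\<close>, \<open>D2\<close> form a regular sequence. Dividing \<open>u\<close>
  by \<open>D2\<close> moves the quotient into the Koszul relation and leaves a remainder of the
  shape handled by \<open>regular_pair_aux\<close>.\<close>

lemma regular_pair:
  fixes u v :: "(3, 'k::field) mpol"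
  assumes "D1 * u + D2 * v = 0"
  obtains q where "u = D2 * q" and "v = - (D1 * q)"
proof -
  obtain q r where u: "u = D2 * q + r"
    and supp: "\<And>x y z. \<alpha>0 + \<beta>0 \<le> x \<Longrightarrow> Poly_Mapping.lookup r (mon x y z) = 0"
    using division_by_D2[of u] by metis
  have "D1 * r + D2 * (v + D1 * q) = 0"
    using assms by (simp add: u algebra_simps)
  from regular_pair_aux[OF this supp] have "r = 0" "v + D1 * q = 0" by auto
  then have "u = D2 * q" "v = - (D1 * q)" using u by (simp_all add: eq_neg_iff_add_eq_0)
  then show ?thesis by (rule that)
qed

text \<open>The two monomials are the third coordinates of the two known syzygies, so this division
  normalizes the third coordinate of an arbitrary syzygy.\<close>

lemma division_by_monomials:
  fixes w :: "(3, 'k::field) mpol"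
  obtains s t r where "w = mpow \<alpha>0 0 0 * s + mpow 0 \<beta>1 0 * t + r"
    and "\<And>x y z. Poly_Mapping.lookup r (mon x y z) \<noteq> 0 \<Longrightarrow> x < \<alpha>0 \<and> y < \<beta>1"
proof -
  let ?J = "{mpow \<alpha>0 0 0 * s + mpow 0 \<beta>1 0 * t | s t. True} :: (3, 'k) mpol set"
  let ?S = "{mon x y z | x y z. x < \<alpha>0 \<and> y < \<beta>1}"
  have J: "mpow \<alpha>0 0 0 * s + mpow 0 \<beta>1 0 * t \<in> ?J" for s t by blast
  have add: "p + q \<in> ?J" if pq: "p \<in> ?J" "q \<in> ?J" for p q
  proof -
    obtain s t s' t' where "p = mpow \<alpha>0 0 0 * s + mpow 0 \<beta>1 0 * t" "q = mpow \<alpha>0 0 0 * s' + mpow 0 \<beta>1 0 * t'"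
      using pq by blast
    then have "p + q = mpow \<alpha>0 0 0 * (s + s') + mpow 0 \<beta>1 0 * (t + t')"
      by (simp add: algebra_simps)
    then show ?thesis by blast
  qed
  have mult: "q * p \<in> ?J" if p: "p \<in> ?J" for p q
  proof -
    obtain s t where "p = mpow \<alpha>0 0 0 * s + mpow 0 \<beta>1 0 * t" using p by blast
    then have "q * p = mpow \<alpha>0 0 0 * (q * s) + mpow 0 \<beta>1 0 * (q * t)"
      by (simp add: algebra_simps)
    then show ?thesis by blast
  qed
  have mono: "\<exists>r. mpow x y z - r \<in> ?J \<and> Poly_Mapping.keys r \<subseteq> ?S" for x y z
  proof -
    consider "\<alpha>0 \<le> x" | "\<beta>1 \<le> y" | "x < \<alpha>0" "y < \<beta>1" by linarith
    then show ?thesis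
    proof cases
      case 1
      then have eq: "mpow x y z - 0 = mpow \<alpha>0 0 0 * mpow (x - \<alpha>0) y z + mpow 0 \<beta>1 0 * (0 :: (3, 'k) mpol)"
        by (simp add: mpow_mult)
      have "mpow x y z - 0 \<in> ?J" unfolding eq by (rule J)
      then show ?thesis by (intro exI[of _ 0]) simp
    next
      case 2
      then have eq: "mpow x y z - 0 = mpow \<alpha>0 0 0 * 0 + mpow 0 \<beta>1 0 * (mpow x (y - \<beta>1) z :: (3, 'k) mpol)"
        by (simp add: mpow_mult)
      have "mpow x y z - 0 \<in> ?J" unfolding eq by (rule J)
      then show ?thesis by (intro exI[of _ 0]) simp
    next
      case 3
      have "mpow x y z - mpow x y z \<in> ?J" using J[of 0 0] by simp
      moreover have "Poly_Mapping.keys (mpow x y z :: (3, 'k) mpol) \<subseteq> ?S" using 3 by (auto simp: mpow_def)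
      ultimately show ?thesis by blast
    qed
  qed
  have "\<exists>r. w - r \<in> ?J \<and> Poly_Mapping.keys r \<subseteq> ?S"
  proof (rule reduce_supported[OF _ add mult])
    show "0 \<in> ?J" using J[of 0 0] by simp
    show "\<exists>r. Poly_Mapping.single m 1 - r \<in> ?J \<and> Poly_Mapping.keys r \<subseteq> ?S" for m
    proof -
      obtain x y z where m: "m = mon x y z" by (rule mon_exhaust)
      show ?thesis using mono[of x y z] unfolding m mpow_def .
    qed
  qed
  then obtain r s t where r: "w - r = mpow \<alpha>0 0 0 * s + mpow 0 \<beta>1 0 * t" "Poly_Mapping.keys r \<subseteq> ?S"
    by blast
  show ?thesis
  proof (rule that)
    show "w = mpow \<alpha>0 0 0 * s + mpow 0 \<beta>1 0 * t + r" using r(1) by (simp add: algebra_simps)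
    show "x < \<alpha>0 \<and> y < \<beta>1" if "Poly_Mapping.lookup r (mon x y z) \<noteq> 0" for x y z
    proof -
      have "mon x y z \<in> ?S" using that r(2) by (auto simp: in_keys_iff)
      then show ?thesis by auto
    qed
  qed
qed

text \<open>Subtracting known syzygies leaves a third coordinate \<open>r\<close> supported where
  \<open>x < \<alpha>0\<close> and \<open>y < \<beta>1\<close>. Such an \<open>r\<close> must
  vanish, and what remains is a Koszul syzygy of \<open>D1\<close> and \<open>D2\<close>.\<close>

lemma syzygy:
  fixes u v w :: "(3, 'k::field) mpol"
  assumes eq: "D1 * u + D2 * v + D3 * w = 0"
  obtains s t where "u = mpow 0 0 \<alpha>2 * s + mpow \<beta>0 0 0 * t"
    and "v = - (mpow 0 \<alpha>1 0 * s + mpow 0 0 \<beta>2 * t)"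
    and "w = mpow \<alpha>0 0 0 * s + mpow 0 \<beta>1 0 * t"
proof -
  obtain s t r where w: "w = mpow \<alpha>0 0 0 * s + mpow 0 \<beta>1 0 * t + r"
    and supp: "\<And>x y z. Poly_Mapping.lookup r (mon x y z) \<noteq> 0 \<Longrightarrow> x < \<alpha>0 \<and> y < \<beta>1"
    using division_by_monomials[of w] by metis
  define u' where "u' = u - (mpow 0 0 \<alpha>2 * s + mpow \<beta>0 0 0 * t)"
  define v' where "v' = v + (mpow 0 \<alpha>1 0 * s + mpow 0 0 \<beta>2 * t)"
  have "D1 * u' + D2 * v' + D3 * r = D1 * u + D2 * v + D3 * w
      - (mpow 0 0 \<alpha>2 * D1 - mpow 0 \<alpha>1 0 * D2 + mpow \<alpha>0 0 0 * D3) * s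
      - (mpow \<beta>0 0 0 * D1 - mpow 0 0 \<beta>2 * D2 + mpow 0 \<beta>1 0 * D3) * t"
    by (simp add: u'_def v'_def w algebra_simps)
  then have eq': "D1 * u' + D2 * v' + D3 * r = 0"
    unfolding eq relation1 relation2 by simp
  have coeff: "Poly_Mapping.lookup (D1 * u') m + Poly_Mapping.lookup (D2 * v') m + Poly_Mapping.lookup (D3 * r) m = 0" for m
    using arg_cong[OF eq', of "\<lambda>p. Poly_Mapping.lookup p m"] by (simp add: lookup_add)
  have "r = 0"
  proof (rule ccontr)
    assume "r \<noteq> 0"
    define Z where "Z = (\<lambda>m. Poly_Mapping.lookup m (2::3)) ` Poly_Mapping.keys r"
    have Z: "finite Z" "Z \<noteq> {}" using \<open>r \<noteq> 0\<close> by (auto simp: Z_def in_keys_iff poly_mapping_eq_iff fun_eq_iff)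
    then obtain m where m: "m \<in> Poly_Mapping.keys r" "Poly_Mapping.lookup m 2 = Max Z"
      using Max_in[OF Z] unfolding Z_def by force
    obtain x y z where xyz: "m = mon x y z" by (rule mon_exhaust)
    have z: "Max Z = z" using m(2) unfolding xyz lookup_mon by simp
    have nz: "Poly_Mapping.lookup r (mon x y z) \<noteq> 0" using m(1) by (simp add: xyz in_keys_iff)
    have top: "Poly_Mapping.lookup r (mon x' y' z') = 0" if "z < z'" for x' y' z'
    proof (rule ccontr)
      assume "Poly_Mapping.lookup r (mon x' y' z') \<noteq> 0"
      then have "Poly_Mapping.lookup (mon x' y' z') 2 \<in> Z" unfolding Z_def by (auto simp: in_keys_iff)
      then have "z' \<in> Z" unfolding lookup_mon by simp
      then show False using Max_ge[OF Z(1)] z that by force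
    qed
    \<comment> \<open>The term of \<open>r\<close> of top degree in \<open>z\<close> times
      \<open>z^(\<alpha>2 + \<beta>2)\<close> cannot cancel. Every term of \<open>D1\<close> and
      \<open>D2\<close> is divisible by \<open>x^\<alpha>0\<close> or \<open>y^\<beta>1\<close>, and
      the other term of \<open>D3\<close> would call for a coefficient of \<open>r\<close> of higher
      degree in \<open>z\<close>.\<close>
    show False
      using coeff[of "mon x y (z + (\<alpha>2 + \<beta>2))"] supp[OF nz] nz top pos
      by (auto simp: D1_def D2_def D3_def left_diff_distrib lookup_minus lookup_mpow_times split: if_splits)
  qed
  then obtain q where q: "u' = D2 * q" "v' = - (D1 * q)"
    using regular_pair[of u' v'] eq' by auto
  \<comment> \<open>The Koszul syzygy \<open>(D2, -D1, 0)\<close> is \<open>x^\<alpha>0\<close>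
    times the second known syzygy minus \<open>y^\<beta>1\<close> times the first; this corrects
    \<open>s\<close> and \<open>t\<close>.\<close>
  show ?thesis
  proof (rule that)
    show "u = mpow 0 0 \<alpha>2 * (s - mpow 0 \<beta>1 0 * q) + mpow \<beta>0 0 0 * (t + mpow \<alpha>0 0 0 * q)"
      using q(1) by (simp add: u'_def D_eqs algebra_simps)
    show "v = - (mpow 0 \<alpha>1 0 * (s - mpow 0 \<beta>1 0 * q) + mpow 0 0 \<beta>2 * (t + mpow \<alpha>0 0 0 * q))"
      using q(2) by (simp add: v'_def D_eqs algebra_simps eq_neg_iff_add_eq_0)
    show "w = mpow \<alpha>0 0 0 * (s - mpow 0 \<beta>1 0 * q) + mpow 0 \<beta>1 0 * (t + mpow \<alpha>0 0 0 * q)"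
      using \<open>r = 0\<close> by (simp add: w algebra_simps)
  qed
qed

lemma syzygies_independent:
  fixes s t :: "(3, 'k::field) mpol"
  assumes eq1: "mpow 0 0 \<alpha>2 * s + mpow \<beta>0 0 0 * t = 0" and eq2: "mpow \<alpha>0 0 0 * s + mpow 0 \<beta>1 0 * t = 0"
  shows "s = 0 \<and> t = 0"
proof -
  \<comment> \<open>Cramer's rule: up to sign, \<open>D2\<close> is the determinant of the two
    equations.\<close>
  have "D2 * s = mpow \<beta>0 0 0 * (mpow \<alpha>0 0 0 * s + mpow 0 \<beta>1 0 * t) - mpow 0 \<beta>1 0 * (mpow 0 0 \<alpha>2 * s + mpow \<beta>0 0 0 * t)"
    by (simp add: D_eqs algebra_simps)
  then have "D2 * s = 0" unfolding eq1 eq2 by simp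
  then have s: "s = 0" by (rule D2_mult_eq_0)
  have "Poly_Mapping.lookup t (mon x y z) = 0" for x y z
    using arg_cong[OF eq1, of "\<lambda>p. Poly_Mapping.lookup p (mon (x + \<beta>0) y z)"]
    by (simp add: s lookup_mpow_times)
  then have "t = 0" by (rule mpol_eq_0I)
  then show ?thesis using s by simp
qed

section \<open>Graded resolutions in the two cases\<close>

lemma homogeneous_D:
  "homogeneous e (int (e 1 * (\<alpha>1 + \<beta>1))) (D1 :: (3, 'k::field) mpol)"
  "homogeneous e (int (e 0 * (\<alpha>0 + \<beta>0))) (D2 :: (3, 'k) mpol)"
  "homogeneous e (int (e 2 * (\<alpha>2 + \<beta>2))) (D3 :: (3, 'k) mpol)"
proof -
  show "homogeneous e (int (e 1 * (\<alpha>1 + \<beta>1))) (D1 :: (3, 'k) mpol)"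
    unfolding D1_def weight1[symmetric] by (intro homogeneous_diff homogeneous_mpow) (use weight1 in auto)
  show "homogeneous e (int (e 0 * (\<alpha>0 + \<beta>0))) (D2 :: (3, 'k) mpol)"
    unfolding D2_def by (intro homogeneous_diff homogeneous_mpow) (use weight2 in auto)
  show "homogeneous e (int (e 2 * (\<alpha>2 + \<beta>2))) (D3 :: (3, 'k) mpol)"
    unfolding D3_def by (intro homogeneous_diff homogeneous_mpow) (use weight3 in auto)
qed

lemma lookup_D_0:
  "Poly_Mapping.lookup (D1 :: (3, 'k::field) mpol) 0 = 0" "Poly_Mapping.lookup (D2 :: (3, 'k) mpol) 0 = 0"
  using pos by (simp_all add: D1_def D2_def lookup_minus lookup_mpow_0)

lemma betti_three_generators:
  assumes "0 < \<beta>1"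
  shows "betti e (monomial_curve_ideal e :: (3, 'k::field_char_0) mpol set) i =
    (if i = 0 then 3 else if i = 1 then 2 else 0)"
proof -
  define A :: "(3, 'k) mpol mat" where "A = mat 1 3 (\<lambda>(i, l). [D1, D2, D3] ! l)"
  define B :: "(3, 'k) mpol mat" where "B = mat 3 2 (\<lambda>(k, l).
    [[mpow 0 0 \<alpha>2, - mpow 0 \<alpha>1 0, mpow \<alpha>0 0 0], [mpow \<beta>0 0 0, - mpow 0 0 \<beta>2, mpow 0 \<beta>1 0]] ! l ! k)"
  define dA where "dA = (\<lambda>l. int ([e 1 * (\<alpha>1 + \<beta>1), e 0 * (\<alpha>0 + \<beta>0), e 2 * (\<alpha>2 + \<beta>2)] ! l))"
  \<comment> \<open>The degree of a relation is the degree of its coefficient at \<open>D1\<close>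
    plus the degree of \<open>D1\<close>.\<close>
  define dB where "dB = (\<lambda>l. int ([e 2 * \<alpha>2 + e 1 * (\<alpha>1 + \<beta>1), e 0 * \<beta>0 + e 1 * (\<alpha>1 + \<beta>1)] ! l))"
  have less3: "k < 3 \<longleftrightarrow> k = 0 \<or> k = Suc 0 \<or> k = Suc (Suc 0)" and less2: "k < 2 \<longleftrightarrow> k = 0 \<or> k = Suc 0" for k :: nat
    by auto
  have A: "A \<in> carrier_mat 1 3" and B: "B \<in> carrier_mat 3 2" by (auto simp: A_def B_def)
  have Au: "(A *\<^sub>v u) $ 0 = D1 * u $ 0 + D2 * u $ 1 + D3 * u $ 2" if "u \<in> carrier_vec 3" for u
    unfolding A_def using that by (subst index_mat_mult_vec) (auto simp: eval_nat_numeral)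
  have Bu: "(B *\<^sub>v u) $ 0 = mpow 0 0 \<alpha>2 * u $ 0 + mpow \<beta>0 0 0 * u $ 1"
    "(B *\<^sub>v u) $ 1 = - (mpow 0 \<alpha>1 0 * u $ 0 + mpow 0 0 \<beta>2 * u $ 1)"
    "(B *\<^sub>v u) $ 2 = mpow \<alpha>0 0 0 * u $ 0 + mpow 0 \<beta>1 0 * u $ 1" if "u \<in> carrier_vec 2" for u
    unfolding B_def using that by (subst index_mat_mult_vec; auto simp: eval_nat_numeral)+
  show ?thesis
  proof (rule betti_short_resolution[OF A B, where dA = dA and dB = dB])
    show "homogeneous e (dA l) (A $$ (0, l))" if "l < 3" for l
      using that homogeneous_D by (auto simp: A_def dA_def less3)
    have w: "int (e 0) * int \<alpha>0 + int (e 2) * int \<beta>2 = int (e 1) * (int \<alpha>1 + int \<beta>1)"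
      "int (e 0) * (int \<alpha>0 + int \<beta>0) = int (e 1) * int \<beta>1 + int (e 2) * int \<alpha>2"
      using arg_cong[OF weight1, of int] arg_cong[OF weight2, of int] by simp_all
    show "homogeneous e (dB l - dA k) (B $$ (k, l))" if "k < 3" "l < 2" for k l
      using that w unfolding less3 less2
      by (elim disjE) (auto simp: B_def dA_def dB_def algebra_simps intro!: homogeneous_mpow homogeneous_uminus)
    show "Poly_Mapping.lookup (B $$ (k, l)) 0 = 0" if "k < 3" "l < 2" for k l
      using that pos assms by (auto simp: less3 less2 B_def lookup_mpow_0)
    show "{(A *\<^sub>v u) $ 0 | u. u \<in> carrier_vec 3} = monomial_curve_ideal e"
    proof -
      have "\<exists>x. D1 * u + D2 * v + D3 * w = (A *\<^sub>v x) $ 0 \<and> x \<in> carrier_vec 3" for u v w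
        by (rule exI[of _ "vec 3 (\<lambda>i. [u, v, w] ! i)"]) (simp add: Au)
      then show ?thesis unfolding curve_ideal_eq minors_def using Au by fastforce
    qed
    show "mat_kernel A = {B *\<^sub>v u | u. u \<in> carrier_vec 2}"
    proof (intro equalityI subsetI)
      fix x assume "x \<in> mat_kernel A"
      then have x: "x \<in> carrier_vec 3" "A *\<^sub>v x = 0\<^sub>v 1" using A by (auto simp: mat_kernel_def)
      have "D1 * x $ 0 + D2 * x $ 1 + D3 * x $ 2 = 0"
        using Au[OF x(1)] x(2) by simp
      then obtain s t where st: "x $ 0 = mpow 0 0 \<alpha>2 * s + mpow \<beta>0 0 0 * t"
        "x $ 1 = - (mpow 0 \<alpha>1 0 * s + mpow 0 0 \<beta>2 * t)" "x $ 2 = mpow \<alpha>0 0 0 * s + mpow 0 \<beta>1 0 * t"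
        by (rule syzygy)
      define u where "u = vec 2 (\<lambda>i. [s, t] ! i)"
      have u: "u \<in> carrier_vec 2" "u $ 0 = s" "u $ 1 = t" by (simp_all add: u_def)
      have "x = B *\<^sub>v u"
      proof (rule eq_vecI)
        fix i assume "i < dim_vec (B *\<^sub>v u)"
        then have "i < 3" using B by simp
        then show "x $ i = (B *\<^sub>v u) $ i"
          using Bu[OF u(1)] unfolding u less3 by (auto simp: st[simplified] simp flip: numeral_2_eq_2)
      qed (use x B in auto)
      then show "x \<in> {B *\<^sub>v u | u. u \<in> carrier_vec 2}" using u(1) by blast
    next
      fix x assume "x \<in> {B *\<^sub>v u | u. u \<in> carrier_vec 2}"
      then obtain u where u: "u \<in> carrier_vec 2" "x = B *\<^sub>v u" by blast
      have x: "x \<in> carrier_vec 3" using B u by auto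
      have "(A *\<^sub>v x) $ 0 = (mpow 0 0 \<alpha>2 * D1 - mpow 0 \<alpha>1 0 * D2 + mpow \<alpha>0 0 0 * D3) * u $ 0 +
          (mpow \<beta>0 0 0 * D1 - mpow 0 0 \<beta>2 * D2 + mpow 0 \<beta>1 0 * D3) * u $ 1"
        unfolding Au[OF x] unfolding u(2) Bu[OF u(1)] by (simp add: algebra_simps)
      then have "(A *\<^sub>v x) $ 0 = 0" unfolding relation1 relation2 by simp
      then have "A *\<^sub>v x = 0\<^sub>v 1" using A by (intro eq_vecI) auto
      then show "x \<in> mat_kernel A" by (rule mat_kernelI[OF A x])
    qed
    show "mat_kernel B = {0\<^sub>v 2}"
    proof (intro equalityI subsetI)
      fix u assume "u \<in> mat_kernel B"
      then have u: "u \<in> carrier_vec 2" "B *\<^sub>v u = 0\<^sub>v 3" using B by (auto simp: mat_kernel_def)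
      have "mpow 0 0 \<alpha>2 * u $ 0 + mpow \<beta>0 0 0 * u $ 1 = 0" "mpow \<alpha>0 0 0 * u $ 0 + mpow 0 \<beta>1 0 * u $ 1 = 0"
        using Bu(1,3)[OF u(1)] u(2) by simp_all
      from syzygies_independent[OF this] have "u = 0\<^sub>v 2"
        using u(1) by (intro eq_vecI) (auto simp: less2)
      then show "u \<in> {0\<^sub>v 2}" by simp
    next
      fix u assume "u \<in> {0\<^sub>v 2 :: (3, 'k) mpol vec}"
      then show "u \<in> mat_kernel B"
        using B by (intro mat_kernelI[OF B]) auto
    qed
  qed
qed

text \<open>With \<open>y^\<beta>1 = 1\<close> the second relation expresses \<open>D3\<close>
  through \<open>D1\<close> and \<open>D2\<close>. The resolution is the Koszul complex of this
  regular pair.\<close>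

lemma betti_two_generators:
  assumes "\<beta>1 = 0"
  shows "betti e (monomial_curve_ideal e :: (3, 'k::field_char_0) mpol set) i =
    (if i = 0 then 2 else if i = 1 then 1 else 0)"
proof -
  define A :: "(3, 'k) mpol mat" where "A = mat 1 2 (\<lambda>(i, l). [D1, D2] ! l)"
  define B :: "(3, 'k) mpol mat" where "B = mat 2 1 (\<lambda>(k, l). [D2, - D1] ! k)"
  define dA where "dA = (\<lambda>l. int ([e 1 * (\<alpha>1 + \<beta>1), e 0 * (\<alpha>0 + \<beta>0)] ! l))"
  define dB where "dB = (\<lambda>l::nat. int (e 1 * (\<alpha>1 + \<beta>1)) + int (e 0 * (\<alpha>0 + \<beta>0)))"
  have less2: "k < 2 \<longleftrightarrow> k = 0 \<or> k = Suc 0" for k :: nat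
    by auto
  have A: "A \<in> carrier_mat 1 2" and B: "B \<in> carrier_mat 2 1" by (auto simp: A_def B_def)
  have Au: "(A *\<^sub>v u) $ 0 = D1 * u $ 0 + D2 * u $ 1" if "u \<in> carrier_vec 2" for u
    unfolding A_def using that by (subst index_mat_mult_vec) (auto simp: eval_nat_numeral)
  have Bu: "(B *\<^sub>v u) $ 0 = D2 * u $ 0" "(B *\<^sub>v u) $ 1 = - (D1 * u $ 0)" if "u \<in> carrier_vec 1" for u
    unfolding B_def using that by (subst index_mat_mult_vec; auto simp: eval_nat_numeral)+
  have D3: "D3 = mpow 0 0 \<beta>2 * D2 - mpow \<beta>0 0 0 * (D1 :: (3, 'k) mpol)"
    unfolding D_eqs by (simp add: assms mpow_0 algebra_simps)
  show ?thesis
  proof (rule betti_short_resolution[OF A B, where dA = dA and dB = dB])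
    show "homogeneous e (dA l) (A $$ (0, l))" if "l < 2" for l
      using that homogeneous_D by (auto simp: A_def dA_def less2)
    show "homogeneous e (dB l - dA k) (B $$ (k, l))" if "k < 2" "l < 1" for k l
      using that homogeneous_D by (auto simp: B_def dA_def dB_def less2 intro!: homogeneous_uminus)
    show "Poly_Mapping.lookup (B $$ (k, l)) 0 = 0" if "k < 2" "l < 1" for k l
      using that by (auto simp: less2 B_def lookup_D_0)
    show "{(A *\<^sub>v u) $ 0 | u. u \<in> carrier_vec 2} = monomial_curve_ideal e"
    proof -
      have "\<exists>x. D1 * u + D2 * v + D3 * w = (A *\<^sub>v x) $ 0 \<and> x \<in> carrier_vec 2" for u v w
        \<comment> \<open>The summand \<open>D3 * w\<close> is distributed over the other two
          generators.\<close>
        by (rule exI[of _ "vec 2 (\<lambda>i. [u - mpow \<beta>0 0 0 * w, v + mpow 0 0 \<beta>2 * w] ! i)"])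
           (simp add: Au D3 algebra_simps)
      moreover have "\<exists>u v w. (A *\<^sub>v x) $ 0 = D1 * u + D2 * v + D3 * w" if "x \<in> carrier_vec 2" for x
        by (rule exI[of _ "x $ 0"], rule exI[of _ "x $ 1"], rule exI[of _ 0]) (simp add: Au[OF that])
      ultimately show ?thesis unfolding curve_ideal_eq minors_def by fastforce
    qed
    show "mat_kernel A = {B *\<^sub>v u | u. u \<in> carrier_vec 1}"
    proof (intro equalityI subsetI)
      fix x assume "x \<in> mat_kernel A"
      then have x: "x \<in> carrier_vec 2" "A *\<^sub>v x = 0\<^sub>v 1" using A by (auto simp: mat_kernel_def)
      have "D1 * x $ 0 + D2 * x $ 1 = 0"
        using Au[OF x(1)] x(2) by simp
      then obtain q where q: "x $ 0 = D2 * q" "x $ 1 = - (D1 * q)"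
        by (rule regular_pair)
      define u where "u = vec 1 (\<lambda>i. q)"
      have u: "u \<in> carrier_vec 1" "u $ 0 = q" by (simp_all add: u_def)
      have "x = B *\<^sub>v u"
      proof (rule eq_vecI)
        fix i assume "i < dim_vec (B *\<^sub>v u)"
        then have "i < 2" using B by simp
        then show "x $ i = (B *\<^sub>v u) $ i"
          using Bu[OF u(1)] unfolding u less2 by (auto simp: q[simplified])
      qed (use x B in auto)
      then show "x \<in> {B *\<^sub>v u | u. u \<in> carrier_vec 1}" using u(1) by blast
    next
      fix x assume "x \<in> {B *\<^sub>v u | u. u \<in> carrier_vec 1}"
      then obtain u where u: "u \<in> carrier_vec 1" "x = B *\<^sub>v u" by blast
      have x: "x \<in> carrier_vec 2" using B u by auto
      have "(A *\<^sub>v x) $ 0 = 0"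
        unfolding Au[OF x] unfolding u(2) Bu[OF u(1)] by (simp add: algebra_simps)
      then have "A *\<^sub>v x = 0\<^sub>v 1" using A by (intro eq_vecI) auto
      then show "x \<in> mat_kernel A" by (rule mat_kernelI[OF A x])
    qed
    show "mat_kernel B = {0\<^sub>v 1}"
    proof (intro equalityI subsetI)
      fix u assume "u \<in> mat_kernel B"
      then have u: "u \<in> carrier_vec 1" "B *\<^sub>v u = 0\<^sub>v 2" using B by (auto simp: mat_kernel_def)
      have "D2 * u $ 0 = 0" using Bu(1)[OF u(1)] u(2) by simp
      then have "u $ 0 = 0" by (rule D2_mult_eq_0)
      then have "u = 0\<^sub>v 1"
        using u(1) by (intro eq_vecI) auto
      then show "u \<in> {0\<^sub>v 1}" by simp
    next
      fix u assume "u \<in> {0\<^sub>v 1 :: (3, 'k) mpol vec}"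
      then show "u \<in> mat_kernel B"
        using B by (intro mat_kernelI[OF B]) auto
    qed
  qed
qed

end

section \<open>Shifted curves\<close>

lemma shifted_curve_exponents:
  fixes a b j :: nat
  assumes "0 < a" "a < b" and j: "b * (2 * b * b) \<le> j"
  obtains \<alpha>0 \<alpha>1 \<alpha>2 \<beta>0 \<beta>1 \<beta>2 where "space_curve (shifted_exponents a b j) \<alpha>0 \<alpha>1 \<alpha>2 \<beta>0 \<beta>1 \<beta>2"
    and "\<beta>1 = 0 \<longleftrightarrow> b div gcd a b dvd j div gcd (gcd a b) j"
proof -
  define g where "g = gcd a b"
  define d where "d = gcd g j"
  have g: "0 < g" using assms by (simp add: g_def)
  then have d: "0 < d" by (simp add: d_def)
  obtain a' b' where ab: "a = a' * g" "b = b' * g" "coprime a' b'"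
    using gcd_coprime_exists[of a b] g unfolding g_def by blast
  obtain s q where sq: "g = s * d" "j = q * d" "coprime s q"
    using gcd_coprime_exists[of g j] d unfolding d_def by blast
  have a': "0 < a'" "a' < b'" using assms(1,2) unfolding ab(1,2) by simp_all
  have "b' \<le> b" using g by (simp add: ab(2))
  then have le_b: "b' \<le> b" "a' \<le> b" using a' by linarith+
  have "d dvd b" unfolding ab(2) sq(1) by simp
  then have "d \<le> b" using assms by (intro dvd_imp_le) auto
  \<comment> \<open>Origin of the bound: \<open>j = q * d\<close> with \<open>d \<le> b\<close>
    yields \<open>q \<ge> 2 * b * b\<close>, which dominates
    \<open>a' * b' + b' * b'\<close>.\<close>
  have "b * (2 * b * b) \<le> b * q"
    using j[unfolded sq(2)] mult_le_mono2[OF \<open>d \<le> b\<close>, of q] unfolding mult.commute[of b q] by (rule le_trans)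
  then have "2 * b * b \<le> q" using assms(1,2) by simp
  moreover have "a' * b' + b' * b' \<le> 2 * b * b"
    using mult_le_mono[OF le_b(2,1)] mult_le_mono[OF le_b(1,1)] by linarith
  ultimately have q: "a' * b' + b' * b' \<le> q" by linarith
  obtain x where x: "[a' * x = Suc 0] (mod b')"
    using cong_solve_coprime_nat[OF ab(3)] by auto
  \<comment> \<open>Since \<open>x\<close> inverts \<open>a'\<close> modulo \<open>b'\<close>, this
    is the residue with \<open>a' * p\<close> congruent to \<open>q\<close>.\<close>
  define p where "p = (x * q) mod b'"
  have p: "p < b'" using a' by (simp add: p_def)
  have "[a' * p = a' * (x * q)] (mod b')"
    unfolding p_def by (intro cong_mult) (auto simp: cong_def)
  also have "[a' * (x * q) = q] (mod b')"
    using cong_scalar_right[OF x, of q] by (simp add: mult.assoc)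
  finally have cong: "[q = a' * p] (mod b')" by (rule cong_sym)
  have apq: "a' * p + b' * b' \<le> q"
    using q p mult_le_mono2[of p b' a'] by linarith
  have "b' dvd q - a' * p"
    using cong apq by (simp add: cong_altdef_nat)
  then obtain t where "q - a' * p = b' * t" by blast
  then have t: "q = a' * p + b' * t" using apq by linarith
  have "b' * b' \<le> b' * t" using apq t by linarith
  then have "b' \<le> t" using a' by simp
  have jq: "int j = int q * int d" "int a = int a' * (int s * int d)" "int b = int b' * (int s * int d)"
    unfolding ab(1,2) sq(1,2) by simp_all
  have tq: "int q = int a' * int p + int b' * int t"
    unfolding t by simp
  \<comment> \<open>Chosen so that \<open>\<alpha>0 + \<beta>0 = s + p + t\<close>, the first
    coordinate of the second lattice vector. Since \<open>b' \<le> t\<close> and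
    \<open>0 < a'\<close>, the truncated subtraction is exact and the result is positive.\<close>
  define \<beta>0 where "\<beta>0 = s + p + t - (b' - a')"
  have \<beta>0: "0 < \<beta>0" "b' - a' + \<beta>0 = s + p + t" using \<open>b' \<le> t\<close> a' by (auto simp: \<beta>0_def)
  have "space_curve (shifted_exponents a b j) (b' - a') (b' - p) t \<beta>0 p a'"
  proof
    have exps: "shifted_exponents a b j 0 = j" "shifted_exponents a b j 1 = j + a" "shifted_exponents a b j 2 = j + b"
      by (simp_all add: shifted_exponents_def)
    show "0 < b' - a'" "0 < b' - p" "0 < t" "0 < \<beta>0" "0 < a'" "0 < shifted_exponents a b j 2"
      using a' p \<beta>0 \<open>b' \<le> t\<close> assms by (auto simp: shifted_exponents_def)
    have "int (j * (b' - a') + (j + b) * a') = int ((j + a) * (b' - p + p))"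
      using a' p by (simp add: of_nat_diff jq algebra_simps)
    then show "shifted_exponents a b j 0 * (b' - a') + shifted_exponents a b j 2 * a' =
        shifted_exponents a b j 1 * (b' - p + p)"
      unfolding exps of_nat_eq_iff .
    have "int (j * (s + p + t)) = int ((j + a) * p + (j + b) * t)"
      by (simp add: jq tq algebra_simps)
    then show "shifted_exponents a b j 0 * (b' - a' + \<beta>0) =
        shifted_exponents a b j 1 * p + shifted_exponents a b j 2 * t"
      unfolding exps \<beta>0 of_nat_eq_iff .
    fix u v w :: int
    assume eq: "int (shifted_exponents a b j 0) * u + int (shifted_exponents a b j 1) * v +
      int (shifted_exponents a b j 2) * w = 0"
    have "int d * (int q * (u + v + w) + int s * (int a' * v + int b' * w)) = 0"
      using eq unfolding exps by (simp add: jq algebra_simps)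
    then have eq1: "int q * (u + v + w) + int s * (int a' * v + int b' * w) = 0"
      using d by simp
    \<comment> \<open>As \<open>s\<close> and \<open>q\<close> are coprime, \<open>s\<close> divides
      every coordinate sum; the quotient is the coefficient \<open>l\<close> of the second vector,
      whose sum is \<open>s\<close>.\<close>
    then have "int s dvd int q * (u + v + w)"
      by (metis add.commute add_eq_0_iff dvd_minus_iff dvd_triv_left)
    moreover have "coprime (int s) (int q)" using sq(3) by simp
    ultimately have "int s dvd u + v + w" by (simp add: coprime_dvd_mult_right_iff)
    then obtain l where l: "u + v + w = int s * l" by blast
    have "int s * (int q * l + (int a' * v + int b' * w)) = 0"
      using eq1 unfolding l by (simp add: algebra_simps)
    then have "int q * l + (int a' * v + int b' * w) = 0"
      using g sq(1) by simp
    \<comment> \<open>Removing \<open>l\<close> times the second vector leaves a solution of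
      \<open>a' V + b' W = 0\<close>; by coprimality it is the multiple \<open>k\<close> of
      \<open>(b', -a')\<close>. The first coordinate is recovered from the sum.\<close>
    then have eq2: "int a' * (v + l * int p) + int b' * (w + l * int t) = 0"
      unfolding tq by (simp add: algebra_simps)
    then have "int b' dvd int a' * (v + l * int p)"
      by (metis add.commute add_eq_0_iff dvd_minus_iff dvd_triv_left)
    moreover have "coprime (int b') (int a')" using ab(3) by (simp add: coprime_commute)
    ultimately have "int b' dvd v + l * int p" by (simp add: coprime_dvd_mult_right_iff)
    then obtain k where k: "v + l * int p = int b' * k" by blast
    have "int b' * (int a' * k + (w + l * int t)) = 0"
      using eq2 unfolding k by (simp add: algebra_simps)
    then have w: "int a' * k + (w + l * int t) = 0" using a' by simp
    have "u = - k * int (b' - a') + l * int (b' - a' + \<beta>0) \<and> v = k * int (b' - p + p) - l * int p \<and>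
        w = - k * int a' - l * int t"
    proof -
      have w': "w = - k * int a' - l * int t" using w by (simp add: algebra_simps)
      have v': "v = k * int b' - l * int p" using k by (simp add: algebra_simps)
      have "u = int s * l - v - w" using l by linarith
      then have "u = - k * (int b' - int a') + l * int (s + p + t)"
        unfolding w' v' by (simp add: algebra_simps)
      then show ?thesis using w' v' p a' \<beta>0 by (simp add: of_nat_diff)
    qed
    then show "\<exists>k l. u = - k * int (b' - a') + l * int (b' - a' + \<beta>0) \<and> v = k * int (b' - p + p) - l * int p \<and>
        w = - k * int a' - l * int t" by blast
  qed
  \<comment> \<open>Modulo \<open>b'\<close> the factor \<open>a'\<close> is a unit and
    \<open>q\<close> is congruent to \<open>a' * p\<close>, while \<open>p < b'\<close>.\<close>
  moreover have "p = 0 \<longleftrightarrow> b' dvd q"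
  proof
    assume "b' dvd q"
    then have "b' dvd a' * p" using t by (metis dvd_add_times_triv_right_iff mult.commute)
    then have "b' dvd p" using ab(3) by (simp add: coprime_dvd_mult_right_iff coprime_commute)
    then show "p = 0" using p by (auto dest: dvd_imp_le)
  qed (simp add: t)
  moreover have "b' = b div gcd a b"
    unfolding g_def[symmetric] using g by (subst ab(2)) simp
  moreover have "q = j div gcd (gcd a b) j"
    unfolding g_def[symmetric] d_def[symmetric] using d by (subst sq(2)) simp
  ultimately show ?thesis using that by metis
qed

text \<open>\<open>g = gcd a b\<close> divides \<open>b\<close>, so the shift preserves
  \<open>d = gcd g j\<close>; the reduced value \<open>j div d\<close> grows by
  \<open>b div d\<close>, a multiple of \<open>b div g\<close>.\<close>

lemma reduced_shift_dvd_periodic: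
  fixes a b j :: nat
  assumes "0 < b"
  shows "b div gcd a b dvd (j + b) div gcd (gcd a b) (j + b) \<longleftrightarrow> b div gcd a b dvd j div gcd (gcd a b) j"
proof -
  define g where "g = gcd a b"
  define d where "d = gcd g j"
  obtain b' where b: "b = g * b'" unfolding g_def by (metis dvdE gcd_dvd2)
  obtain s where g: "g = d * s" unfolding d_def by (metis dvdE gcd_dvd1)
  obtain q where j: "j = d * q" unfolding d_def by (metis dvdE gcd_dvd2)
  have pos: "0 < g" "0 < d" using assms by (simp_all add: g_def d_def)
  have gcd: "gcd g (j + b) = d"
    unfolding b d_def by (metis gcd_add_mult add.commute mult.commute)
  have "(j + b) div d = q + s * b'"
  proof -
    have "j + b = d * (q + s * b')" unfolding b g j by (simp add: algebra_simps)
    then show ?thesis using pos by simp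
  qed
  moreover have "j div d = q" using pos by (simp add: j)
  moreover have "b div g = b'" using pos by (simp add: b)
  ultimately show ?thesis
    unfolding g_def[symmetric] gcd d_def[symmetric] by (simp add: dvd_add_left_iff)
qed

lemma betti_shifted_curve:
  fixes a b j :: nat
  assumes "0 < a" "a < b" "b * (2 * b * b) \<le> j"
  shows "betti (shifted_exponents a b j) (shifted_curve_ideal a b j :: (3, 'k::field_char_0) mpol set) i =
    (if b div gcd a b dvd j div gcd (gcd a b) j
     then if i = 0 then 2 else if i = 1 then 1 else 0
     else if i = 0 then 3 else if i = 1 then 2 else 0)"
proof -
  obtain \<alpha>0 \<alpha>1 \<alpha>2 \<beta>0 \<beta>1 \<beta>2 where "space_curve (shifted_exponents a b j) \<alpha>0 \<alpha>1 \<alpha>2 \<beta>0 \<beta>1 \<beta>2"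
    and \<beta>1: "\<beta>1 = 0 \<longleftrightarrow> b div gcd a b dvd j div gcd (gcd a b) j"
    using shifted_curve_exponents[OF assms] by metis
  then interpret space_curve "shifted_exponents a b j" \<alpha>0 \<alpha>1 \<alpha>2 \<beta>0 \<beta>1 \<beta>2 by simp
  show ?thesis
  proof (cases "\<beta>1 = 0")
    case True
    then show ?thesis
      unfolding shifted_curve_ideal_def betti_two_generators[OF True] using \<beta>1 by simp
  next
    case False
    then have "0 < \<beta>1" by simp
    then show ?thesis
      unfolding shifted_curve_ideal_def betti_three_generators[OF \<open>0 < \<beta>1\<close>] using \<beta>1 by simp
  qed
qed

theorem theorem1p5:
  fixes a b :: nat
  assumes "0 < a" and "a < b"
  shows "\<exists>N>0. \<forall>j\<ge>N. \<forall>i.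
           betti (shifted_exponents a b j)
             (shifted_curve_ideal a b j :: (3, 'k::field_char_0) mpol set) i =
           betti (shifted_exponents a b (j + b))
             (shifted_curve_ideal a b (j + b) :: (3, 'k) mpol set) i"
proof (intro exI conjI allI impI)
  show "0 < b * (2 * b * b)" using assms by simp
  fix j i assume j: "b * (2 * b * b) \<le> j"
  then have j': "b * (2 * b * b) \<le> j + b" by simp
  show "betti (shifted_exponents a b j)
      (shifted_curve_ideal a b j :: (3, 'k::field_char_0) mpol set) i =
    betti (shifted_exponents a b (j + b))
      (shifted_curve_ideal a b (j + b) :: (3, 'k) mpol set) i"
    unfolding betti_shifted_curve[OF assms j] betti_shifted_curve[OF assms j']
    using reduced_shift_dvd_periodic[of b a j] assms by simp
qed

end
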